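(* Let $X \in GL_r(\mathbb{Z})$ and let $\lambda_1,\ldots,\lambda_r$ be the eigenvalues of $X$. Then for every $n \geq 1$, $$ D_n=n^{2}\,[\det X]^{n-1}\prod_{1\leq i< j\leq r}\left(\frac{\lambda_i^n-\lambda_j^n}{\lambda_i-\lambda_j}\right)^2 $$ is an integer, and the sequence $\{D_n\}_{n\in\mathbb{N}}$ is a determinant divisibility sequence.
   Context: A divisibility sequence is a sequence $\{d_n\}_{n\in\mathbb{N}}$ of integers such that $n\mid m$ implies $d_n\mid d_m$. Let $S$ be a commutative ring with $1$, let $(\Gamma,\cdot)$ be a semigroup, and fix a faithful representation $[\cdot]:\Gamma\hookrightarrow \mathrm{End}(\mathbb{A}^m_S)$, $\alpha\mapsto[\alpha]$, of $\Gamma$ by endomorphisms of affine $m$-dimensional space over $S$. For $x\in\mathbb{A}^m_S$, the matrix divisibility sequence associated to $(\Gamma,[\cdot])$ is the sequence of $m\times m$ Jacobian matrices $\{J_\alpha(x)\}_{\alpha\in\Gamma}$ with entries $[J_\alpha(x)]_{i,j}=\partial(([\alpha](x))_i)/\partial x_j$, where $([\alpha](x))_i$ is the $i$-th entry of $[\alpha](x)$. The associated determinant divisibility sequence is $\{\det J_\alpha(x)\}_{\alpha\in\Gamma}$. The setting for the claim is $\Gamma=\mathbb{N}$ (positive integers under multiplication) and $m=r^2$: an $r\times r$ matrix $Y=[Y_{ij}]$ is identified with the point $(Y_{11},\ldots,Y_{1r},\ldots,Y_{r1},\ldots,Y_{rr})$ of $\mathbb{A}^{r^2}$, and $[n]:\mathbb{A}^{r^2}\to\mathbb{A}^{r^2}$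 sends the point of $Y$ to the point of $Y^n$; the Jacobians $J_n$ are evaluated at $X$. When $\lambda_i=\lambda_j$, the quotient $\frac{\lambda_i^n-\lambda_j^n}{\lambda_i-\lambda_j}$ is understood as the polynomial expression $\sum_{k=0}^{n-1}\lambda_i^k\lambda_j^{n-1-k}$.
   Formalization: For Y↦Y^n, det J_n(X) has factor n^r, not n^2 (r=1, X=(1), n=2: 2, not 4), so n^r is proved there. The printed n^2 sequence is proved an integer divisibility sequence, and a determinant divisibility sequence over Q for another representation on A^(r^2+1). *)

theory Defs
  imports
    "HOL-Library.Poly_Mapping"
    "Jordan_Normal_Form.Matrix"
    "Jordan_Normal_Form.Determinant"
    "Jordan_Normal_Form.Char_Poly"
begin

text \<open>
  Polynomials over \<open>'a\<close> in the variables \<open>x 0, x 1, \<dots>\<close>: finitely supported maps from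
  exponent vectors to coefficients.  The product on this type is the convolution product, so
  this is the usual polynomial ring.
\<close>

type_synonym 'a mpoly = "(nat \<Rightarrow>\<^sub>0 nat) \<Rightarrow>\<^sub>0 'a"

definition mvar :: "nat \<Rightarrow> 'a::comm_ring_1 mpoly" where
  "mvar i = Poly_Mapping.single (Poly_Mapping.single i 1) 1"

definition mvars :: "'a::comm_ring_1 mpoly \<Rightarrow> nat set" where
  "mvars p = (\<Union>e\<in>Poly_Mapping.keys p. Poly_Mapping.keys e)"

text \<open>Substitution of \<open>f i\<close> for \<open>x i\<close>, the coefficients being mapped along \<open>c\<close>.\<close>

definition minsert ::
    "('a::comm_ring_1 \<Rightarrow> 'b::comm_ring_1) \<Rightarrow> (nat \<Rightarrow> 'b) \<Rightarrow> 'a mpoly \<Rightarrow> 'b" where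
  "minsert c f p = (\<Sum>e\<in>Poly_Mapping.keys p. c (Poly_Mapping.lookup p e) * (\<Prod>i\<in>Poly_Mapping.keys e. f i ^ Poly_Mapping.lookup e i))"

definition meval :: "'a::comm_ring_1 vec \<Rightarrow> 'a mpoly \<Rightarrow> 'a" where
  "meval x p = minsert id (\<lambda>i. x $ i) p"

definition msubst :: "'a::comm_ring_1 mpoly vec \<Rightarrow> 'a mpoly \<Rightarrow> 'a mpoly" where
  "msubst f p = minsert (Poly_Mapping.single 0) (\<lambda>i. f $ i) p"

definition mpderiv :: "nat \<Rightarrow> 'a::comm_ring_1 mpoly \<Rightarrow> 'a mpoly" where
  "mpderiv j p = (\<Sum>e\<in>Poly_Mapping.keys p.
     Poly_Mapping.single (e - Poly_Mapping.single j 1) (of_nat (Poly_Mapping.lookup e j) * Poly_Mapping.lookup p e))"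

text \<open>
  An endomorphism of affine \<open>m\<close>-space over \<open>'a\<close> is an \<open>m\<close>-tuple of polynomials in \<open>m\<close>
  variables (not merely the polynomial function it induces on \<open>'a\<close>-valued points).
\<close>

definition affine_End :: "nat \<Rightarrow> 'a::comm_ring_1 mpoly vec set" where
  "affine_End m = {f \<in> carrier_vec m. \<forall>i<m. mvars (f $ i) \<subseteq> {..<m}}"

definition affine_comp ::
    "'a::comm_ring_1 mpoly vec \<Rightarrow> 'a mpoly vec \<Rightarrow> 'a mpoly vec" where
  "affine_comp f g = map_vec (msubst g) f"

text \<open>The semigroup is a multiplicatively closed subset \<open>G\<close> of its type.\<close>

definition faithful_representation ::
    "'g::semigroup_mult set \<Rightarrow> nat \<Rightarrow> ('g \<Rightarrow> 'a::comm_ring_1 mpoly vec) \<Rightarrow> bool" where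
  "faithful_representation G m \<rho> \<longleftrightarrow>
     (\<forall>\<alpha>\<in>G. \<forall>\<beta>\<in>G. \<alpha> * \<beta> \<in> G) \<and>
     (\<forall>\<alpha>\<in>G. \<rho> \<alpha> \<in> affine_End m) \<and>
     (\<forall>\<alpha>\<in>G. \<forall>\<beta>\<in>G. \<rho> (\<alpha> * \<beta>) = affine_comp (\<rho> \<alpha>) (\<rho> \<beta>)) \<and>
     inj_on \<rho> G"

definition jacobian ::
    "nat \<Rightarrow> 'a::comm_ring_1 mpoly vec \<Rightarrow> 'a vec \<Rightarrow> 'a mat" where
  "jacobian m f x = mat m m (\<lambda>(i, j). meval x (mpderiv j (f $ i)))"

text \<open>The determinant divisibility sequence attached to a representation and a point.\<close>

definition det_div_seq ::
    "nat \<Rightarrow> ('g \<Rightarrow> 'a::comm_ring_1 mpoly vec) \<Rightarrow> 'a vec \<Rightarrow> 'g \<Rightarrow> 'a" where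
  "det_div_seq m \<rho> x \<alpha> = det (jacobian m (\<rho> \<alpha>) x)"

definition is_det_div_seq ::
    "'g::semigroup_mult set \<Rightarrow> ('g \<Rightarrow> 'a::comm_ring_1) \<Rightarrow> bool" where
  "is_det_div_seq G d \<longleftrightarrow>
     (\<exists>m \<rho> x. faithful_representation G m \<rho> \<and> x \<in> carrier_vec m \<and>
        (\<forall>\<alpha>\<in>G. d \<alpha> = det_div_seq m \<rho> x \<alpha>))"

definition divisibility_sequence :: "(nat \<Rightarrow> int) \<Rightarrow> bool" where
  "divisibility_sequence d \<longleftrightarrow> (\<forall>n\<ge>1. \<forall>m\<ge>1. n dvd m \<longrightarrow> d n dvd d m)"

text \<open>
  Row-major identification of \<open>r \<times> r\<close> matrices with points of affine \<open>r\<^sup>2\<close>-space: with indices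
  starting at 0, the entry \<open>(i, j)\<close> is the coordinate \<open>i * r + j\<close>.
\<close>

definition point_of_mat :: "nat \<Rightarrow> 'a mat \<Rightarrow> 'a vec" where
  "point_of_mat r A = vec (r * r) (\<lambda>k. A $$ (k div r, k mod r))"

definition generic_mat :: "nat \<Rightarrow> 'a::comm_ring_1 mpoly mat" where
  "generic_mat r = mat r r (\<lambda>(i, j). mvar (i * r + j))"

definition matrix_power_endo :: "nat \<Rightarrow> nat \<Rightarrow> 'a::comm_ring_1 mpoly vec" where
  "matrix_power_endo r n = point_of_mat r (generic_mat r ^\<^sub>m n)"

definition power_quotient :: "nat \<Rightarrow> complex \<Rightarrow> complex \<Rightarrow> complex" where
  "power_quotient n a b =
     (if a = b then (\<Sum>k<n. a ^ k * b ^ (n - 1 - k)) else (a ^ n - b ^ n) / (a - b))"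

end

theory Submission
  imports Defs "Jordan_Normal_Form.Schur_Decomposition"
begin

text \<open>
  The differential of \<open>Y \<mapsto> Y\<^sup>n\<close> at \<open>X\<close> sends \<open>Z\<close> to \<open>\<Sum>k<n. X\<^sup>k Z X\<^bsup>n-1-k\<^esup>\<close>, so in row-major
  coordinates the Jacobian is the sum of the Kronecker products of \<open>X\<^sup>k\<close> with the transpose of
  \<open>X\<^bsup>n-1-k\<^esup>\<close> (\<open>jacobian_matrix_power_endo\<close>).  Over the complex numbers \<open>X\<close> and its transpose are
  both similar to upper triangular matrices with the eigenvalues \<open>\<lambda>\<^sub>i\<close> on the diagonal, in the
  same order, and these similarities make the whole sum upper triangular with diagonal entries
  \<open>q\<^sub>n(\<lambda>\<^sub>i, \<lambda>\<^sub>j) = \<Sum>k<n. \<lambda>\<^sub>i\<^sup>k \<lambda>\<^sub>j\<^bsup>n-1-k\<^esup>\<close>, the quotient \<open>(\<lambda>\<^sub>i\<^sup>n - \<lambda>\<^sub>j\<^sup>n) / (\<lambda>\<^sub>i - \<lambda>\<^sub>j)\<close>.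
  Collecting the diagonal pairs \<open>i = j\<close>, which contribute \<open>n \<lambda>\<^sub>i\<^bsup>n-1\<^esup>\<close>, and the symmetric pairs
  \<open>i \<noteq> j\<close> gives the Jacobian determinant \<open>J\<^sub>n = n\<^sup>r (det X)\<^bsup>n-1\<^esup> F\<^sub>n(X)\<close> with
  \<open>F\<^sub>n(X) = \<Prod>i<j. q\<^sub>n(\<lambda>\<^sub>i, \<lambda>\<^sub>j)\<^sup>2\<close> (\<open>det_div_seq_matrix_power\<close>).

  The factor \<open>F\<^sub>n(X)\<close> is itself an integer (\<open>eigen_quotient_Ints\<close>): it is a polynomial with
  integer coefficients in the algebraic integers \<open>\<lambda>\<^sub>i\<close>, hence an algebraic integer, and it is
  rational because \<open>J\<^sub>n\<close>, \<open>n\<close> and \<open>det X\<close> are integers and the last two are nonzero.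

  Divisibility comes from \<open>q\<^bsub>nk\<^esub>(a, b) = q\<^sub>n(a, b) q\<^sub>k(a\<^sup>n, b\<^sup>n)\<close>.  It gives
  \<open>F\<^bsub>nk\<^esub>(X) = F\<^sub>n(X) F\<^sub>k(X\<^sup>n)\<close>, where \<open>F\<^sub>k(X\<^sup>n)\<close> is an integer because \<open>X\<^sup>n\<close> is again an
  integer matrix.  So \<open>n\<^sup>s (det X)\<^bsup>n-1\<^esup> F\<^sub>n(X)\<close> is a divisibility sequence for every \<open>s\<close>.

  The representation on matrices produces the exponent \<open>s = r\<close>.  To realise \<open>s = 2\<close>, a further
  coordinate is adjoined on which \<open>n\<close> acts as multiplication by \<open>n\<^bsup>2-r\<^esup>\<close>; this is
  multiplicative in \<open>n\<close>, and it multiplies the Jacobian determinant by \<open>n\<^bsup>2-r\<^esup>\<close>.  For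
  \<open>r > 2\<close> and \<open>n > 1\<close> the scalar is not an integer, so this representation lives over the
  rationals.
\<close>

section \<open>Polynomials in several variables\<close>

lemma mpoly_induct [case_names zero single add]:
  fixes p :: "'a::comm_ring_1 mpoly"
  assumes "P 0" and "\<And>e a. P (Poly_Mapping.single e a)"
    and "\<And>p q. P p \<Longrightarrow> P q \<Longrightarrow> P (p + q)"
  shows "P p"
proof (induction p rule: Poly_Mapping.update_induct)
  case const
  show ?case by (rule assms(1))
next
  case (update f e b)
  have "Poly_Mapping.update e b f = Poly_Mapping.single e b + f"
    using update by (intro poly_mapping_eqI)
      (auto simp: lookup_update lookup_add lookup_single when_def in_keys_iff)
  with assms(2,3) update show ?case by metis
qed

lemma monomial_value_superset:
  fixes f :: "nat \<Rightarrow> 'b::comm_monoid_mult"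
  assumes "finite S" "Poly_Mapping.keys e \<subseteq> S"
  shows "(\<Prod>i\<in>Poly_Mapping.keys e. f i ^ Poly_Mapping.lookup e i)
         = (\<Prod>i\<in>S. f i ^ Poly_Mapping.lookup e i)"
  using assms by (intro prod.mono_neutral_left) (auto simp: in_keys_iff)

lemma monomial_value_add:
  fixes f :: "nat \<Rightarrow> 'b::comm_monoid_mult"
  shows "(\<Prod>i\<in>Poly_Mapping.keys (d + e). f i ^ Poly_Mapping.lookup (d + e) i)
         = (\<Prod>i\<in>Poly_Mapping.keys d. f i ^ Poly_Mapping.lookup d i)
         * (\<Prod>i\<in>Poly_Mapping.keys e. f i ^ Poly_Mapping.lookup e i)"
proof -
  let ?S = "Poly_Mapping.keys d \<union> Poly_Mapping.keys e"
  have "Poly_Mapping.keys (d + e) \<subseteq> ?S" by (rule Poly_Mapping.keys_add)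
  then show ?thesis
    by (subst (1 2 3) monomial_value_superset[of ?S])
      (simp_all add: lookup_add power_add prod.distrib)
qed

text \<open>
  The sum defining a substitution runs over the support, which changes when polynomials are
  added; enlarging the index set to a common superset makes additivity termwise.
\<close>

lemma minsert_superset:
  assumes "c 0 = 0" "finite S" "Poly_Mapping.keys p \<subseteq> S"
  shows "minsert c f p = (\<Sum>e\<in>S. c (Poly_Mapping.lookup p e) *
           (\<Prod>i\<in>Poly_Mapping.keys e. f i ^ Poly_Mapping.lookup e i))"
  unfolding minsert_def using assms
  by (intro sum.mono_neutral_left) (auto simp: in_keys_iff)

lemma minsert_single:
  assumes "c 0 = 0"
  shows "minsert c f (Poly_Mapping.single e a) =
           c a * (\<Prod>i\<in>Poly_Mapping.keys e. f i ^ Poly_Mapping.lookup e i)"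
  using assms by (subst minsert_superset[where S = "{e}"]) auto

lemma minsert_mvar:
  assumes "c 0 = 0" "c 1 = 1"
  shows "minsert c f (mvar i) = f i"
  using assms by (simp add: mvar_def minsert_single)

lemma minsert_comm_ring_hom:
  assumes "comm_ring_hom c"
  shows "comm_ring_hom (minsert c f)"
proof -
  interpret comm_ring_hom c by fact
  have add: "minsert c f (p + q) = minsert c f p + minsert c f q" for p q
  proof -
    let ?S = "Poly_Mapping.keys p \<union> Poly_Mapping.keys q"
    have "Poly_Mapping.keys (p + q) \<subseteq> ?S" by (rule Poly_Mapping.keys_add)
    then show ?thesis
      by (simp add: minsert_superset[of c ?S] lookup_add hom_add algebra_simps sum.distrib)
  qed
  have zero: "minsert c f 0 = 0" by (simp add: minsert_def)
  have single: "minsert c f (Poly_Mapping.single d a * q) =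
      minsert c f (Poly_Mapping.single d a) * minsert c f q" for d a q
  proof (induction q rule: mpoly_induct)
    case (single e b)
    show ?case by (simp add: mult_single minsert_single hom_mult monomial_value_add mult_ac)
  qed (simp_all add: zero add distrib_left)
  have mult: "minsert c f (p * q) = minsert c f p * minsert c f q" for p q
    by (induction p rule: mpoly_induct) (simp_all add: zero add distrib_right single)
  have one: "minsert c f 1 = 1"
    by (simp add: minsert_single flip: single_one)
  show ?thesis
    by unfold_locales (simp_all add: add mult one zero)
qed

lemma single_zero_comm_ring_hom:
  "comm_ring_hom (Poly_Mapping.single 0 :: 'a::comm_ring_1 \<Rightarrow> 'a mpoly)"
  by unfold_locales (simp_all add: single_add mult_single)

lemma meval_comm_ring_hom: "comm_ring_hom (meval x :: 'a::comm_ring_1 mpoly \<Rightarrow> 'a)"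
proof -
  have "comm_ring_hom (id :: 'a \<Rightarrow> 'a)" by unfold_locales auto
  from minsert_comm_ring_hom[OF this] show ?thesis by (simp add: meval_def[abs_def])
qed

lemma msubst_comm_ring_hom: "comm_ring_hom (msubst g)"
  unfolding msubst_def[abs_def]
  by (intro minsert_comm_ring_hom single_zero_comm_ring_hom)

lemma meval_mvar: "meval x (mvar i) = x $ i"
  by (simp add: meval_def minsert_mvar)

lemma msubst_mvar: "msubst g (mvar i) = g $ i"
  by (simp add: msubst_def minsert_mvar)

lemma msubst_single_var:
  "msubst g (Poly_Mapping.single (Poly_Mapping.single i 1) a) = Poly_Mapping.single 0 a * g $ i"
  by (simp add: msubst_def minsert_single)

lemma mpderiv_superset:
  assumes "finite S" "Poly_Mapping.keys p \<subseteq> S"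
  shows "mpderiv j p = (\<Sum>e\<in>S. Poly_Mapping.single (e - Poly_Mapping.single j 1)
           (of_nat (Poly_Mapping.lookup e j) * Poly_Mapping.lookup p e))"
  unfolding mpderiv_def using assms
  by (intro sum.mono_neutral_left) (auto simp: in_keys_iff)

lemma mpderiv_zero [simp]: "mpderiv j 0 = 0"
  by (simp add: mpderiv_def)

lemma mpderiv_single:
  "mpderiv j (Poly_Mapping.single e a) =
     Poly_Mapping.single (e - Poly_Mapping.single j 1) (of_nat (Poly_Mapping.lookup e j) * a)"
  by (subst mpderiv_superset[where S = "{e}"]) auto

lemma mpderiv_add: "mpderiv j (p + q) = mpderiv j p + mpderiv j q"
proof -
  let ?S = "Poly_Mapping.keys p \<union> Poly_Mapping.keys q"
  have "Poly_Mapping.keys (p + q) \<subseteq> ?S" by (rule Poly_Mapping.keys_add)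
  then show ?thesis
    by (simp add: mpderiv_superset[of ?S] lookup_add distrib_left single_add sum.distrib)
qed

lemma mpderiv_sum: "mpderiv j (sum p A) = (\<Sum>i\<in>A. mpderiv j (p i))"
  by (induction A rule: infinite_finite_induct) (simp_all add: mpderiv_add)

text \<open>
  By bilinearity the product rule need only be checked on monomials.  Exponents are subtracted
  with truncation there, which is harmless: where it would matter, the coefficient
  \<open>of_nat (lookup d j)\<close> is zero.
\<close>

lemma mpderiv_mult:
  fixes p q :: "'a::comm_ring_1 mpoly"
  shows "mpderiv j (p * q) = mpderiv j p * q + p * mpderiv j q"
proof -
  have shift: "Poly_Mapping.single (d + e - Poly_Mapping.single j 1) (of_nat (Poly_Mapping.lookup d j) * a)
      = Poly_Mapping.single (d - Poly_Mapping.single j 1 + e) (of_nat (Poly_Mapping.lookup d j) * a)"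
    for d e :: "nat \<Rightarrow>\<^sub>0 nat" and a :: 'a
  proof (cases "Poly_Mapping.lookup d j = 0")
    case False
    then have "d + e - Poly_Mapping.single j 1 = d - Poly_Mapping.single j 1 + e"
      by (intro poly_mapping_eqI) (auto simp: lookup_add lookup_minus lookup_single when_def)
    then show ?thesis by simp
  qed simp
  have monomials: "mpderiv j (Poly_Mapping.single d a * Poly_Mapping.single e b) =
      mpderiv j (Poly_Mapping.single d a) * Poly_Mapping.single e b
      + Poly_Mapping.single d a * mpderiv j (Poly_Mapping.single e b)"
    for d e :: "nat \<Rightarrow>\<^sub>0 nat" and a b :: 'a
    using shift[of d e "a * b"] shift[of e d "a * b"]
    by (simp add: mult_single mpderiv_single lookup_add distrib_left distrib_right single_add
        add_ac mult_ac)
  have monomial_left: "mpderiv j (Poly_Mapping.single d a * q) =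
      mpderiv j (Poly_Mapping.single d a) * q + Poly_Mapping.single d a * mpderiv j q"
    for d :: "nat \<Rightarrow>\<^sub>0 nat" and a :: 'a and q
  proof (induction q rule: mpoly_induct)
    case (single e b)
    show ?case by (rule monomials)
  qed (simp_all add: mpderiv_add algebra_simps)
  show ?thesis
  proof (induction p rule: mpoly_induct)
    case (single d a)
    show ?case by (rule monomial_left)
  qed (simp_all add: mpderiv_add algebra_simps)
qed

lemma mpderiv_one [simp]: "mpderiv j (1 :: 'a::comm_ring_1 mpoly) = 0"
  using mpderiv_single[of j 0 "1::'a"] by simp

lemma mpderiv_mvar: "mpderiv j (mvar i) = (if i = j then 1 else (0 :: 'a::comm_ring_1 mpoly))"
  by (simp add: mvar_def mpderiv_single lookup_single when_def)

lemma mvars_add: "mvars (p + q) \<subseteq> mvars p \<union> mvars q"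
  unfolding mvars_def using Poly_Mapping.keys_add[of p q] by blast

lemma mvars_mult: "mvars (p * q) \<subseteq> mvars p \<union> mvars q"
  unfolding mvars_def using Poly_Mapping.keys_mult[of p q] Poly_Mapping.keys_add by fastforce

lemma mvars_sum: "mvars (sum p A) \<subseteq> (\<Union>i\<in>A. mvars (p i))"
proof (induction A rule: infinite_finite_induct)
  case (insert x F)
  then show ?case using mvars_add[of "p x" "sum p F"] by auto
qed (simp_all add: mvars_def)

lemma mvars_zero_one [simp]: "mvars 0 = {}" "mvars (1 :: 'a::comm_ring_1 mpoly) = {}"
  by (simp_all add: mvars_def)

lemma mvars_single_var: "mvars (Poly_Mapping.single (Poly_Mapping.single i 1) a) \<subseteq> {i}"
  by (auto simp: mvars_def)

lemma mvars_mvar: "mvars (mvar i) \<subseteq> {i}"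
  unfolding mvar_def by (rule mvars_single_var)

lemma mvars_mpderiv: "mvars (mpderiv j p) \<subseteq> mvars p"
proof -
  have "mvars (mpderiv j p) \<subseteq> (\<Union>e\<in>Poly_Mapping.keys p.
      mvars (Poly_Mapping.single (e - Poly_Mapping.single j 1)
        (of_nat (Poly_Mapping.lookup e j) * Poly_Mapping.lookup p e)))"
    unfolding mpderiv_def by (rule mvars_sum)
  also have "\<dots> \<subseteq> (\<Union>e\<in>Poly_Mapping.keys p. Poly_Mapping.keys e)"
    by (intro UN_mono) (auto simp: mvars_def in_keys_iff lookup_minus)
  finally show ?thesis unfolding mvars_def .
qed

lemma mpderiv_eq_0:
  assumes "j \<notin> mvars p"
  shows "mpderiv j p = 0"
  using assms unfolding mpderiv_def mvars_def by (intro sum.neutral) (auto simp: in_keys_iff)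

text \<open>
  Substitution depends only on the variables that occur.  This is what allows polynomials in
  \<open>m\<close> variables to be regarded as polynomials in \<open>m + 1\<close> variables.
\<close>

lemma minsert_cong:
  assumes "\<And>i. i \<in> mvars p \<Longrightarrow> f i = g i"
  shows "minsert c f p = minsert c g p"
proof -
  have "f i = g i" if "e \<in> Poly_Mapping.keys p" "i \<in> Poly_Mapping.keys e" for e i
    using that by (intro assms) (auto simp: mvars_def)
  then show ?thesis unfolding minsert_def by simp
qed

section \<open>Row-major indices\<close>

lemma row_major_index:
  assumes "i < r" "j < (r::nat)"
  shows "i * r + j < r * r" "(i * r + j) div r = i" "(i * r + j) mod r = j"
proof -
  have "i * r + j < Suc i * r" using assms by simp
  also have "\<dots> \<le> r * r" using assms by (intro mult_le_mono1) simp
  finally show "i * r + j < r * r" .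
qed (use assms in auto)

lemma row_major_index_inverse:
  assumes "p < r * (r::nat)"
  shows "p div r < r" "p mod r < r" "p div r * r + p mod r = p"
  using assms by (auto simp: less_mult_imp_div_less intro!: mod_less_divisor gr0I)

lemma sum_row_major:
  "(\<Sum>p<r * r. f p) = (\<Sum>i<r. \<Sum>j<(r::nat). f (i * r + j))"
proof -
  have "(\<Sum>p<r * r. f p) = (\<Sum>(i, j)\<in>{..<r} \<times> {..<r}. f (i * r + j))"
    by (rule sum.reindex_bij_witness[where i = "\<lambda>(i, j). i * r + j" and j = "\<lambda>p. (p div r, p mod r)"])
      (auto simp: row_major_index row_major_index_inverse)
  then show ?thesis by (simp add: sum.cartesian_product)
qed

lemma prod_row_major:
  "(\<Prod>p<r * r. f p) = (\<Prod>i<r. \<Prod>j<(r::nat). f (i * r + j))"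
proof -
  have "(\<Prod>p<r * r. f p) = (\<Prod>(i, j)\<in>{..<r} \<times> {..<r}. f (i * r + j))"
    by (rule prod.reindex_bij_witness[where i = "\<lambda>(i, j). i * r + j" and j = "\<lambda>p. (p div r, p mod r)"])
      (auto simp: row_major_index row_major_index_inverse)
  then show ?thesis by (simp add: prod.cartesian_product)
qed

section \<open>Powers of matrices\<close>

lemma mult_mat_entry:
  assumes "A \<in> carrier_mat m n" "B \<in> carrier_mat n k" "i < m" "j < k"
  shows "(A * B) $$ (i, j) = (\<Sum>l<n. A $$ (i, l) * B $$ (l, j))"
  using assms by (simp add: scalar_prod_def atLeast0LessThan)

lemma pow_mat_add:
  assumes "A \<in> carrier_mat n n"
  shows "A ^\<^sub>m (k + l) = A ^\<^sub>m k * A ^\<^sub>m l"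
proof (induction l)
  case (Suc l)
  then show ?case using assms by (simp add: assoc_mult_mat[of _ n n _ n _ n])
qed (use assms in simp)

lemma pow_mat_mult:
  assumes "A \<in> carrier_mat n n"
  shows "(A ^\<^sub>m l) ^\<^sub>m k = A ^\<^sub>m (k * l)"
proof (induction k)
  case (Suc k)
  then show ?case using assms pow_mat_add[OF assms, of "k * l" l] by (simp add: add.commute)
qed (use assms in simp)

lemma transpose_pow_mat:
  fixes A :: "'a::comm_ring_1 mat"
  assumes "A \<in> carrier_mat n n"
  shows "(A\<^sup>T) ^\<^sub>m k = (A ^\<^sub>m k)\<^sup>T"
proof (induction k)
  case (Suc k)
  have "(A\<^sup>T) ^\<^sub>m Suc k = (A * A ^\<^sub>m k)\<^sup>T"
    using Suc assms by (simp add: transpose_mult[of _ n n _ n])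
  also have "A * A ^\<^sub>m k = A ^\<^sub>m Suc k"
    using pow_mat_add[OF assms, of 1 k] assms by simp
  finally show ?case .
qed (use assms in simp)

lemma upper_triangular_mult:
  fixes A B :: "'a::comm_ring_1 mat"
  assumes A: "A \<in> carrier_mat n n" "upper_triangular A"
    and B: "B \<in> carrier_mat n n" "upper_triangular B"
  shows "upper_triangular (A * B)"
    and "i < n \<Longrightarrow> (A * B) $$ (i, i) = A $$ (i, i) * B $$ (i, i)"
proof -
  show "upper_triangular (A * B)"
  proof (rule upper_triangularI)
    fix i j assume ij: "j < i" "i < dim_row (A * B)"
    have "A $$ (i, l) * B $$ (l, j) = 0" if "l < n" for l
    proof (cases "l < i")
      case True
      then show ?thesis using upper_triangularD[OF A(2), of l i] A ij by simp
    next
      case False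
      then show ?thesis using upper_triangularD[OF B(2), of j l] B ij that by simp
    qed
    then show "(A * B) $$ (i, j) = 0"
      using ij A(1) B(1) by (subst mult_mat_entry[OF A(1) B(1)]) simp_all
  qed
  assume i: "i < n"
  \<comment> \<open>A nonzero summand has \<open>i \<le> l\<close> because of \<open>A\<close> and \<open>l \<le> i\<close> because of \<open>B\<close>.\<close>
  have only_diagonal: "A $$ (i, l) * B $$ (l, i) = (if l = i then A $$ (i, i) * B $$ (i, i) else 0)"
    if l: "l < n" for l
  proof (cases l i rule: linorder_cases)
    case less
    then show ?thesis using upper_triangularD[OF A(2), of l i] A(1) i by simp
  next
    case greater
    then show ?thesis using upper_triangularD[OF B(2), of i l] B(1) l by simp
  qed simp
  have "(A * B) $$ (i, i) = (\<Sum>l<n. if l = i then A $$ (i, i) * B $$ (i, i) else 0)"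
    unfolding mult_mat_entry[OF A(1) B(1) i i] by (intro sum.cong only_diagonal) auto
  then show "(A * B) $$ (i, i) = A $$ (i, i) * B $$ (i, i)"
    using i by simp
qed

lemma upper_triangular_pow:
  fixes A :: "'a::comm_ring_1 mat"
  assumes A: "A \<in> carrier_mat n n" "upper_triangular A"
  shows "upper_triangular (A ^\<^sub>m k)"
    and "i < n \<Longrightarrow> (A ^\<^sub>m k) $$ (i, i) = A $$ (i, i) ^ k"
proof (induction k)
  case 0
  show "upper_triangular (A ^\<^sub>m 0)" using A by auto
  show "(A ^\<^sub>m 0) $$ (i, i) = A $$ (i, i) ^ 0" if "i < n" using A that by simp
next
  case (Suc k)
  have Ak: "A ^\<^sub>m k \<in> carrier_mat n n" using A by simp
  show "upper_triangular (A ^\<^sub>m Suc k)"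
    using upper_triangular_mult(1)[OF Ak Suc(1) A] by simp
  show "(A ^\<^sub>m Suc k) $$ (i, i) = A $$ (i, i) ^ Suc k" if "i < n"
    using upper_triangular_mult(2)[OF Ak Suc(1) A that] Suc(2)[OF that] by (simp add: mult.commute)
qed

section \<open>Kronecker products\<close>

definition kronecker :: "nat \<Rightarrow> 'a::comm_ring_1 mat \<Rightarrow> 'a mat \<Rightarrow> 'a mat" where
  "kronecker r A B = mat (r * r) (r * r)
     (\<lambda>(p, q). A $$ (p div r, q div r) * B $$ (p mod r, q mod r))"

text \<open>
  The matrix \<open>\<Sum>k<n. A\<^sup>k \<otimes> B\<^bsup>n-1-k\<^esup>\<close>, that is \<open>(a\<^sup>n - b\<^sup>n) / (a - b)\<close> evaluated at the
  commuting matrices \<open>a = A \<otimes> 1\<close> and \<open>b = 1 \<otimes> B\<close>.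
\<close>

definition kronecker_quotient :: "nat \<Rightarrow> nat \<Rightarrow> 'a::comm_ring_1 mat \<Rightarrow> 'a mat \<Rightarrow> 'a mat" where
  "kronecker_quotient r n A B = mat (r * r) (r * r)
     (\<lambda>(p, q). \<Sum>k<n. kronecker r (A ^\<^sub>m k) (B ^\<^sub>m (n - 1 - k)) $$ (p, q))"

lemma kronecker_carrier [simp]: "kronecker r A B \<in> carrier_mat (r * r) (r * r)"
  by (simp add: kronecker_def)

lemma kronecker_quotient_carrier [simp]:
  "kronecker_quotient r n A B \<in> carrier_mat (r * r) (r * r)"
  by (simp add: kronecker_quotient_def)

lemma kronecker_one: "kronecker r (1\<^sub>m r) (1\<^sub>m r) = 1\<^sub>m (r * r)"
proof (rule eq_matI)
  fix p q assume "p < dim_row (1\<^sub>m (r * r) :: 'a mat)" "q < dim_col (1\<^sub>m (r * r) :: 'a mat)"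
  then have pq: "p < r * r" "q < r * r" by simp_all
  then have "(p div r = q div r \<and> p mod r = q mod r) = (p = q)"
    by (metis div_mult_mod_eq)
  then show "kronecker r (1\<^sub>m r) (1\<^sub>m r) $$ (p, q) = (1\<^sub>m (r * r) :: 'a mat) $$ (p, q)"
    using pq by (auto simp: kronecker_def row_major_index_inverse)
qed (simp_all add: kronecker_def)

lemma kronecker_mult:
  assumes "A \<in> carrier_mat r r" "B \<in> carrier_mat r r" "C \<in> carrier_mat r r" "D \<in> carrier_mat r r"
  shows "kronecker r A B * kronecker r C D = kronecker r (A * C) (B * D)"
proof (rule eq_matI)
  fix p q assume "p < dim_row (kronecker r (A * C) (B * D))" "q < dim_col (kronecker r (A * C) (B * D))"
  then have pq: "p < r * r" "q < r * r" by (simp_all add: kronecker_def)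
  then have "(kronecker r A B * kronecker r C D) $$ (p, q) =
      (\<Sum>s<r * r. (A $$ (p div r, s div r) * B $$ (p mod r, s mod r)) *
        (C $$ (s div r, q div r) * D $$ (s mod r, q mod r)))"
    by (subst mult_mat_entry[of _ "r * r" "r * r" _ "r * r"]) (auto simp: kronecker_def)
  also have "\<dots> = (\<Sum>a<r. \<Sum>b<r. (A $$ (p div r, a) * C $$ (a, q div r)) *
        (B $$ (p mod r, b) * D $$ (b, q mod r)))"
    by (simp add: sum_row_major row_major_index mult_ac)
  also have "\<dots> = (A * C) $$ (p div r, q div r) * (B * D) $$ (p mod r, q mod r)"
    using assms pq
    by (simp add: mult_mat_entry[of _ r r _ r] row_major_index_inverse sum_product
        del: index_mult_mat)
  finally show "(kronecker r A B * kronecker r C D) $$ (p, q) = kronecker r (A * C) (B * D) $$ (p, q)"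
    using pq by (simp add: kronecker_def)
qed (simp_all add: kronecker_def)

lemma mult_mat_sum_mult_entry:
  fixes L R :: "'a::comm_ring_1 mat"
  assumes "L \<in> carrier_mat N N" "R \<in> carrier_mat N N" "\<And>k. k \<in> K \<Longrightarrow> F k \<in> carrier_mat N N"
    and "p < N" "q < N"
  shows "(L * mat N N (\<lambda>(i, j). \<Sum>k\<in>K. F k $$ (i, j)) * R) $$ (p, q) =
    (\<Sum>k\<in>K. (L * F k * R) $$ (p, q))"
proof -
  have entry: "(L * M * R) $$ (p, q) = (\<Sum>t<N. \<Sum>s<N. L $$ (p, s) * M $$ (s, t) * R $$ (t, q))"
    if M: "M \<in> carrier_mat N N" for M
  proof -
    have "(L * M * R) $$ (p, q) = (\<Sum>t<N. (L * M) $$ (p, t) * R $$ (t, q))"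
      by (rule mult_mat_entry) (use assms M in auto)
    also have "\<dots> = (\<Sum>t<N. (\<Sum>s<N. L $$ (p, s) * M $$ (s, t)) * R $$ (t, q))"
      using assms M by (intro sum.cong refl arg_cong2[where f = "(*)"] mult_mat_entry) auto
    finally show ?thesis by (simp add: sum_distrib_right)
  qed
  have "(L * mat N N (\<lambda>(i, j). \<Sum>k\<in>K. F k $$ (i, j)) * R) $$ (p, q) =
      (\<Sum>t<N. \<Sum>s<N. \<Sum>k\<in>K. L $$ (p, s) * F k $$ (s, t) * R $$ (t, q))"
    by (subst entry) (auto simp: sum_distrib_left sum_distrib_right)
  also have "\<dots> = (\<Sum>k\<in>K. \<Sum>t<N. \<Sum>s<N. L $$ (p, s) * F k $$ (s, t) * R $$ (t, q))"
    by (subst sum.swap[of _ K]) (subst sum.swap[of _ K], simp)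
  also have "\<dots> = (\<Sum>k\<in>K. (L * F k * R) $$ (p, q))"
    using assms(3) by (intro sum.cong) (simp_all add: entry del: index_mult_mat)
  finally show ?thesis .
qed

text \<open>
  Conjugation by \<open>P \<otimes> S\<close> acts on every summand \<open>A\<^sup>k \<otimes> B\<^sup>l\<close> at once, by multiplicativity of the
  Kronecker product.
\<close>

lemma similar_kronecker_quotient:
  fixes A B :: "'a::comm_ring_1 mat"
  assumes A: "A \<in> carrier_mat r r" "similar_mat_wit A U P Q"
    and B: "B \<in> carrier_mat r r" "similar_mat_wit B V S T"
  shows "similar_mat (kronecker_quotient r n A B) (kronecker_quotient r n U V)"
proof (rule similar_matI[where n = "r * r"])
  note wA = similar_mat_witD2[OF A] and wB = similar_mat_witD2[OF B]
  let ?L = "kronecker r P S" and ?R = "kronecker r Q T"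
  note carr = wA(5-7) wB(5-7)
  show "?L * ?R = 1\<^sub>m (r * r)" "?R * ?L = 1\<^sub>m (r * r)"
    using carr wA(1,2) wB(1,2) by (simp_all add: kronecker_mult kronecker_one)
  have conj: "?L * kronecker r (U ^\<^sub>m k) (V ^\<^sub>m l) * ?R = kronecker r (A ^\<^sub>m k) (B ^\<^sub>m l)" for k l
    using carr
    by (simp add: kronecker_mult similar_mat_wit_pow_id[OF A(2), of k]
        similar_mat_wit_pow_id[OF B(2), of l])
  show "kronecker_quotient r n A B = ?L * kronecker_quotient r n U V * ?R"
  proof (rule eq_matI)
    fix p q assume "p < dim_row (?L * kronecker_quotient r n U V * ?R)"
      "q < dim_col (?L * kronecker_quotient r n U V * ?R)"
    then have pq: "p < r * r" "q < r * r" by (simp_all add: kronecker_def)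
    show "kronecker_quotient r n A B $$ (p, q) = (?L * kronecker_quotient r n U V * ?R) $$ (p, q)"
      unfolding kronecker_quotient_def
      by (subst mult_mat_sum_mult_entry[of _ "r * r"]) (use pq in \<open>simp_all add: conj\<close>)
  qed (simp_all add: kronecker_quotient_def kronecker_def)
qed simp

text \<open>
  The row-major order of index pairs is lexicographic.  If \<open>q < p\<close>, then either the first
  index of \<open>q\<close> is smaller, where the powers of \<open>U\<close> vanish, or the first indices agree and the
  second is smaller, where the powers of \<open>V\<close> vanish.  Hence the matrix is upper triangular.
\<close>

lemma det_kronecker_quotient_upper_triangular:
  fixes U V :: "'a::comm_ring_1 mat"
  assumes U: "U \<in> carrier_mat r r" "upper_triangular U"
    and V: "V \<in> carrier_mat r r" "upper_triangular V"
  shows "det (kronecker_quotient r n U V) =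
    (\<Prod>i<r. \<Prod>j<r. \<Sum>k<n. U $$ (i, i) ^ k * V $$ (j, j) ^ (n - 1 - k))"
proof -
  let ?M = "kronecker_quotient r n U V"
  have entry: "?M $$ (p, q) =
      (\<Sum>k<n. (U ^\<^sub>m k) $$ (p div r, q div r) * (V ^\<^sub>m (n - 1 - k)) $$ (p mod r, q mod r))"
    if "p < r * r" "q < r * r" for p q
    using that by (simp add: kronecker_quotient_def kronecker_def)
  have "upper_triangular ?M"
  proof (rule upper_triangularI)
    fix p q assume "q < p" "p < dim_row ?M"
    then have pq: "q < p" "p < r * r" "q < r * r" by (simp_all add: kronecker_quotient_def)
    have "(U ^\<^sub>m k) $$ (p div r, q div r) * (V ^\<^sub>m l) $$ (p mod r, q mod r) = 0" for k l
    proof (cases "q div r < p div r")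
      case True
      then show ?thesis
        using upper_triangularD[OF upper_triangular_pow(1)[OF U, of k] True] U pq
        by (simp add: row_major_index_inverse)
    next
      case False
      then have "p div r = q div r" using div_le_mono[of q p r] pq by simp
      then have "q mod r < p mod r"
        using pq(1) by (metis add_less_cancel_left div_mult_mod_eq)
      then show ?thesis
        using upper_triangularD[OF upper_triangular_pow(1)[OF V, of l]] V pq
        by (simp add: row_major_index_inverse)
    qed
    then show "?M $$ (p, q) = 0" using pq by (simp add: entry)
  qed
  then have "det ?M = (\<Prod>p<r * r. ?M $$ (p, p))"
    by (subst det_upper_triangular[of _ "r * r"])
      (simp_all add: prod_list_diag_prod atLeast0LessThan kronecker_quotient_def)
  also have "\<dots> = (\<Prod>i<r. \<Prod>j<r. \<Sum>k<n. U $$ (i, i) ^ k * V $$ (j, j) ^ (n - 1 - k))"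
    unfolding prod_row_major
    by (intro prod.cong refl)
      (simp add: entry row_major_index upper_triangular_pow(2)[OF U] upper_triangular_pow(2)[OF V])
  finally show ?thesis .
qed

section \<open>The power map as a representation\<close>

definition mat_of_point :: "nat \<Rightarrow> 'a vec \<Rightarrow> 'a mat" where
  "mat_of_point r x = mat r r (\<lambda>(i, j). x $ (i * r + j))"

lemma mat_of_point_carrier [simp]: "mat_of_point r x \<in> carrier_mat r r"
  by (simp add: mat_of_point_def)

lemma mat_of_point_of_mat:
  assumes "A \<in> carrier_mat r r"
  shows "mat_of_point r (point_of_mat r A) = A"
  using assms by (intro eq_matI) (auto simp: mat_of_point_def point_of_mat_def row_major_index)

lemma generic_mat_carrier [simp]: "generic_mat r \<in> carrier_mat r r"
  by (simp add: generic_mat_def)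

lemma generic_mat_dim [simp]: "dim_row (generic_mat r) = r" "dim_col (generic_mat r) = r"
  by (simp_all add: generic_mat_def)

lemma generic_mat_index:
  "i < r \<Longrightarrow> j < r \<Longrightarrow> generic_mat r $$ (i, j) = mvar (i * r + j)"
  by (simp add: generic_mat_def)

lemma map_mat_meval_generic_power:
  "map_mat (meval x) (generic_mat r ^\<^sub>m n) = mat_of_point r x ^\<^sub>m n"
proof -
  interpret comm_ring_hom "meval x" by (rule meval_comm_ring_hom)
  have "map_mat (meval x) (generic_mat r) = mat_of_point r x"
    by (rule eq_matI) (simp_all add: generic_mat_def mat_of_point_def meval_mvar)
  then show ?thesis by (simp add: mat_hom_pow[of _ r])
qed

lemma map_mat_msubst_generic_power:
  "map_mat (msubst g) (generic_mat r ^\<^sub>m n) = mat_of_point r g ^\<^sub>m n"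
proof -
  interpret comm_ring_hom "msubst g" by (rule msubst_comm_ring_hom)
  have "map_mat (msubst g) (generic_mat r) = mat_of_point r g"
    by (rule eq_matI) (simp_all add: generic_mat_def mat_of_point_def msubst_mvar)
  then show ?thesis by (simp add: mat_hom_pow[of _ r])
qed

lemma mvars_generic_power:
  assumes "i < r" "j < r"
  shows "mvars ((generic_mat r ^\<^sub>m n :: 'a::comm_ring_1 mpoly mat) $$ (i, j)) \<subseteq> {..<r * r}"
  using assms
proof (induction n arbitrary: i j)
  case 0
  then show ?case by (simp add: generic_mat_def)
next
  case (Suc n)
  have "mvars ((generic_mat r ^\<^sub>m n :: 'a mpoly mat) $$ (i, l) * generic_mat r $$ (l, j)) \<subseteq> {..<r * r}"
    if "l < r" for l
  proof -
    have "mvars (generic_mat r $$ (l, j) :: 'a mpoly) \<subseteq> {..<r * r}"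
      using mvars_mvar[where 'a = 'a, of "l * r + j"] row_major_index(1)[of l r j] Suc.prems that
      by (auto simp: generic_mat_index)
    with Suc.IH[of i l] Suc.prems that show ?thesis
      by (intro order_trans[OF mvars_mult]) auto
  qed
  moreover have "(generic_mat r ^\<^sub>m Suc n :: 'a mpoly mat) $$ (i, j) =
      (\<Sum>l<r. (generic_mat r ^\<^sub>m n) $$ (i, l) * generic_mat r $$ (l, j))"
    using Suc.prems by (simp add: mult_mat_entry[of _ r r _ r] del: index_mult_mat)
  ultimately show ?case
    using mvars_sum[of "\<lambda>l. (generic_mat r ^\<^sub>m n :: 'a mpoly mat) $$ (i, l) * generic_mat r $$ (l, j)" "{..<r}"]
    by fastforce
qed

lemma matrix_power_endo_index:
  "p < r * r \<Longrightarrow> matrix_power_endo r n $ p = (generic_mat r ^\<^sub>m n) $$ (p div r, p mod r)"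
  by (simp add: matrix_power_endo_def point_of_mat_def)

lemma matrix_power_endo_carrier [simp]: "matrix_power_endo r n \<in> carrier_vec (r * r)"
  by (simp add: matrix_power_endo_def point_of_mat_def)

lemma matrix_power_endo_dim [simp]: "dim_vec (matrix_power_endo r n) = r * r"
  by (simp add: matrix_power_endo_def point_of_mat_def)

text \<open>
  Substitution is a ring homomorphism, so substituting the entries of \<open>Y\<^sup>b\<close> into those of \<open>Y\<^sup>a\<close>
  is the same as raising the matrix \<open>Y\<^sup>b\<close> to the power \<open>a\<close>.
\<close>

lemma affine_comp_matrix_power_endo:
  "affine_comp (matrix_power_endo r a) (matrix_power_endo r b) =
     (matrix_power_endo r (a * b) :: 'a::comm_ring_1 mpoly vec)"
proof (rule eq_vecI)
  fix p assume "p < dim_vec (matrix_power_endo r (a * b) :: 'a mpoly vec)"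
  then have p: "p < r * r" by simp
  note idx = row_major_index_inverse[OF p]
  have "affine_comp (matrix_power_endo r a) (matrix_power_endo r b :: 'a mpoly vec) $ p
      = map_mat (msubst (matrix_power_endo r b)) (generic_mat r ^\<^sub>m a) $$ (p div r, p mod r)"
    using p idx by (simp add: affine_comp_def matrix_power_endo_index)
  also have "\<dots> = (mat_of_point r (matrix_power_endo r b) ^\<^sub>m a) $$ (p div r, p mod r)"
    by (simp only: map_mat_msubst_generic_power)
  also have "mat_of_point r (matrix_power_endo r b) = (generic_mat r ^\<^sub>m b :: 'a mpoly mat)"
    unfolding matrix_power_endo_def by (rule mat_of_point_of_mat) simp
  finally show "affine_comp (matrix_power_endo r a) (matrix_power_endo r b :: 'a mpoly vec) $ p
      = matrix_power_endo r (a * b) $ p"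
    using p by (simp add: pow_mat_mult[of _ r] matrix_power_endo_index)
qed (simp add: affine_comp_def)

text \<open>
  The exponent can be read off at the scalar matrix \<open>2\<close>, whose \<open>n\<close>-th power has \<open>2\<^sup>n\<close> in the
  top left corner.
\<close>

lemma inj_matrix_power_endo:
  assumes "r \<ge> 1"
  shows "inj (matrix_power_endo r :: nat \<Rightarrow> 'a::{comm_ring_1,ring_char_0} mpoly vec)"
proof (rule injI)
  fix a b assume eq: "(matrix_power_endo r a :: 'a mpoly vec) = matrix_power_endo r b"
  let ?x = "point_of_mat r (2 \<cdot>\<^sub>m 1\<^sub>m r :: 'a mat)"
  have "meval ?x (matrix_power_endo r n $ 0) = 2 ^ n" for n
  proof -
    have "meval ?x (matrix_power_endo r n $ 0) = map_mat (meval ?x) (generic_mat r ^\<^sub>m n) $$ (0, 0)"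
      using assms by (simp add: matrix_power_endo_index)
    also have "\<dots> = ((2 \<cdot>\<^sub>m 1\<^sub>m r :: 'a mat) ^\<^sub>m n) $$ (0, 0)"
      by (simp add: map_mat_meval_generic_power mat_of_point_of_mat)
    also have "\<dots> = 2 ^ n"
      by (subst upper_triangular_pow(2)[of _ r]) (use assms in auto)
    finally show ?thesis .
  qed
  with eq have "(of_nat (2 ^ a) :: 'a) = of_nat (2 ^ b)" by (metis of_nat_numeral of_nat_power)
  then show "a = b" by (simp only: of_nat_eq_iff) simp
qed

lemma faithful_matrix_power_endo:
  assumes "r \<ge> 1"
  shows "faithful_representation {1..} (r * r)
           (matrix_power_endo r :: nat \<Rightarrow> 'a::{comm_ring_1,ring_char_0} mpoly vec)"
  unfolding faithful_representation_def
proof (intro conjI ballI)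
  show "inj_on (matrix_power_endo r :: nat \<Rightarrow> 'a mpoly vec) {1..}"
    using inj_matrix_power_endo[OF assms] by (rule inj_on_subset) simp
  show "matrix_power_endo r n \<in> (affine_End (r * r) :: 'a mpoly vec set)" for n
    using mvars_generic_power[where 'a = 'a and r = r and n = n]
    by (simp add: affine_End_def matrix_power_endo_index row_major_index_inverse)
qed (auto simp: affine_comp_matrix_power_endo)

section \<open>The Jacobian of the power map\<close>

text \<open>
  Differentiating \<open>Y\<^sup>n\<close> with respect to the entry \<open>(a, b)\<close> replaces each of the \<open>n\<close> factors in turn
  by the matrix unit \<open>E\<close> at \<open>(a, b)\<close>; the entry \<open>(i, j)\<close> of \<open>X\<^sup>k E X\<^bsup>n-1-k\<^esup>\<close> is
  the summand below.
\<close>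

lemma meval_mpderiv_generic_power:
  fixes X :: "'a::comm_ring_1 mat"
  assumes X: "X \<in> carrier_mat r r" and "i < r" "j < r" and a: "a < r" and b: "b < r"
  shows "meval (point_of_mat r X) (mpderiv (a * r + b) ((generic_mat r ^\<^sub>m n) $$ (i, j))) =
    (\<Sum>k<n. (X ^\<^sub>m k) $$ (i, a) * (X ^\<^sub>m (n - 1 - k)) $$ (b, j))"
  using assms(2,3)
proof (induction n arbitrary: i j)
  case 0
  then show ?case by (simp add: generic_mat_def meval_def minsert_def)
next
  case (Suc n)
  let ?x = "point_of_mat r X" and ?G = "generic_mat r :: 'a mpoly mat" and ?d = "mpderiv (a * r + b)"
  interpret comm_ring_hom "meval ?x" by (rule meval_comm_ring_hom)
  have eval: "meval ?x ((?G ^\<^sub>m m) $$ (p, q)) = (X ^\<^sub>m m) $$ (p, q)" if "p < r" "q < r" for m p q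
    using arg_cong[OF map_mat_meval_generic_power[of ?x r m], of "\<lambda>A. A $$ (p, q)"] that X
    by (simp add: mat_of_point_of_mat)
  have deriv: "meval ?x (?d (?G $$ (l, j))) = (if l = a \<and> j = b then 1 else 0)" if "l < r" for l
  proof -
    have "l * r + j = a * r + b \<longleftrightarrow> l = a \<and> j = b"
      using row_major_index[of l r j] row_major_index[of a r b] that Suc.prems a b by metis
    then show ?thesis using that Suc.prems by (simp add: generic_mat_index mpderiv_mvar)
  qed
  have "(?G ^\<^sub>m Suc n) $$ (i, j) = (\<Sum>l<r. (?G ^\<^sub>m n) $$ (i, l) * ?G $$ (l, j))"
    using Suc.prems by (simp add: mult_mat_entry[of _ r r _ r] del: index_mult_mat)
  then have "meval ?x (?d ((?G ^\<^sub>m Suc n) $$ (i, j))) =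
      (\<Sum>l<r. meval ?x (?d ((?G ^\<^sub>m n) $$ (i, l))) * meval ?x (?G $$ (l, j))) +
      (\<Sum>l<r. meval ?x ((?G ^\<^sub>m n) $$ (i, l)) * meval ?x (?d (?G $$ (l, j))))"
    by (simp add: mpderiv_sum mpderiv_mult hom_sum hom_add hom_mult sum.distrib)
  also have "(\<Sum>l<r. meval ?x (?d ((?G ^\<^sub>m n) $$ (i, l))) * meval ?x (?G $$ (l, j))) =
      (\<Sum>l<r. (\<Sum>k<n. (X ^\<^sub>m k) $$ (i, a) * (X ^\<^sub>m (n - 1 - k)) $$ (b, l)) * X $$ (l, j))"
  proof (intro sum.cong refl arg_cong2[where f = "(*)"])
    fix l assume "l \<in> {..<r}"
    then show "meval ?x (?d ((?G ^\<^sub>m n) $$ (i, l))) =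
        (\<Sum>k<n. (X ^\<^sub>m k) $$ (i, a) * (X ^\<^sub>m (n - 1 - k)) $$ (b, l))"
      and "meval ?x (?G $$ (l, j)) = X $$ (l, j)"
      using Suc.IH[of i l] Suc.prems eval[of l j 1] X by simp_all
  qed
  also have "\<dots> = (\<Sum>k<n. (X ^\<^sub>m k) $$ (i, a) * (\<Sum>l<r. (X ^\<^sub>m (n - 1 - k)) $$ (b, l) * X $$ (l, j)))"
    by (simp add: sum_distrib_left sum_distrib_right mult.assoc) (rule sum.swap)
  also have "\<dots> = (\<Sum>k<n. (X ^\<^sub>m k) $$ (i, a) * (X ^\<^sub>m (n - k)) $$ (b, j))"
  proof (intro sum.cong refl arg_cong2[where f = "(*)"])
    fix k assume "k \<in> {..<n}"
    then have "n - k = Suc (n - 1 - k)" by simp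
    then have "X ^\<^sub>m (n - k) = X ^\<^sub>m (n - 1 - k) * X" by (simp only: pow_mat.simps)
    then show "(\<Sum>l<r. (X ^\<^sub>m (n - 1 - k)) $$ (b, l) * X $$ (l, j)) = (X ^\<^sub>m (n - k)) $$ (b, j)"
      using X b Suc.prems by (simp only: mult_mat_entry[OF pow_carrier_mat[OF X] X])
  qed
  also have "(\<Sum>l<r. meval ?x ((?G ^\<^sub>m n) $$ (i, l)) * meval ?x (?d (?G $$ (l, j)))) =
      (\<Sum>l<r. if l = a then (if j = b then (X ^\<^sub>m n) $$ (i, a) else 0) else 0)"
    using Suc.prems by (intro sum.cong refl) (auto simp: eval deriv)
  also have "\<dots> = (X ^\<^sub>m n) $$ (i, a) * (X ^\<^sub>m (n - n)) $$ (b, j)"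
    using a b X Suc.prems by (auto simp: one_mat_def)
  finally show ?case by simp
qed

lemma jacobian_matrix_power_endo:
  fixes X :: "'a::comm_ring_1 mat"
  assumes X: "X \<in> carrier_mat r r"
  shows "jacobian (r * r) (matrix_power_endo r n) (point_of_mat r X) = kronecker_quotient r n X (X\<^sup>T)"
proof (rule eq_matI)
  fix p q assume "p < dim_row (kronecker_quotient r n X (X\<^sup>T))" "q < dim_col (kronecker_quotient r n X (X\<^sup>T))"
  then have pq: "p < r * r" "q < r * r" by (simp_all add: kronecker_quotient_def)
  note p = row_major_index_inverse[OF pq(1)] and q = row_major_index_inverse[OF pq(2)]
  have "jacobian (r * r) (matrix_power_endo r n) (point_of_mat r X) $$ (p, q) =
      (\<Sum>k<n. (X ^\<^sub>m k) $$ (p div r, q div r) * (X ^\<^sub>m (n - 1 - k)) $$ (q mod r, p mod r))"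
    using meval_mpderiv_generic_power[OF X p(1,2) q(1,2), of n] pq q(3)
    by (simp add: jacobian_def matrix_power_endo_index)
  then show "jacobian (r * r) (matrix_power_endo r n) (point_of_mat r X) $$ (p, q) =
      kronecker_quotient r n X (X\<^sup>T) $$ (p, q)"
    using pq p q X by (simp add: kronecker_quotient_def kronecker_def transpose_pow_mat[OF X])
qed (simp_all add: jacobian_def kronecker_quotient_def)

section \<open>Adjoining a scaled coordinate\<close>

definition adjoin_scaling ::
    "nat \<Rightarrow> 'a::comm_ring_1 \<Rightarrow> 'a mpoly vec \<Rightarrow> 'a mpoly vec" where
  "adjoin_scaling m c f = vec (Suc m)
     (\<lambda>k. if k < m then f $ k else Poly_Mapping.single (Poly_Mapping.single m 1) c)"

text \<open>
  A direct sum with a one-dimensional linear representation: faithfulness is inherited from \<open>\<rho>\<close>,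
  whatever the multiplicative character \<open>c\<close> may be.
\<close>

lemma faithful_adjoin_scaling:
  fixes \<rho> :: "'g::semigroup_mult \<Rightarrow> 'a::comm_ring_1 mpoly vec"
  assumes \<rho>: "faithful_representation G m \<rho>"
    and c: "\<And>\<alpha> \<beta>. \<alpha> \<in> G \<Longrightarrow> \<beta> \<in> G \<Longrightarrow> c (\<alpha> * \<beta>) = c \<alpha> * c \<beta>"
  shows "faithful_representation G (Suc m) (\<lambda>\<alpha>. adjoin_scaling m (c \<alpha>) (\<rho> \<alpha>))"
  unfolding faithful_representation_def
proof (intro conjI ballI)
  fix \<alpha> \<beta> assume G: "\<alpha> \<in> G" "\<beta> \<in> G"
  note \<rho>' = \<rho>[unfolded faithful_representation_def affine_End_def]
  show "\<alpha> * \<beta> \<in> G" using \<rho>' G by blast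
  let ?g = "adjoin_scaling m (c \<beta>) (\<rho> \<beta>)"
  show "adjoin_scaling m (c (\<alpha> * \<beta>)) (\<rho> (\<alpha> * \<beta>)) = affine_comp (adjoin_scaling m (c \<alpha>) (\<rho> \<alpha>)) ?g"
  proof (rule eq_vecI)
    fix k assume "k < dim_vec (affine_comp (adjoin_scaling m (c \<alpha>) (\<rho> \<alpha>)) ?g)"
    then consider "k < m" | "k = m" by (fastforce simp: affine_comp_def adjoin_scaling_def)
    then show "adjoin_scaling m (c (\<alpha> * \<beta>)) (\<rho> (\<alpha> * \<beta>)) $ k =
        affine_comp (adjoin_scaling m (c \<alpha>) (\<rho> \<alpha>)) ?g $ k"
    proof cases
      case 1
      have "msubst ?g (\<rho> \<alpha> $ k) = msubst (\<rho> \<beta>) (\<rho> \<alpha> $ k)"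
        unfolding msubst_def using 1 \<rho>' G
        by (intro minsert_cong) (fastforce simp: adjoin_scaling_def)
      moreover have "\<rho> (\<alpha> * \<beta>) = affine_comp (\<rho> \<alpha>) (\<rho> \<beta>)" "\<rho> \<alpha> \<in> carrier_vec m" using \<rho>' G by auto
      ultimately show ?thesis using 1 by (simp add: adjoin_scaling_def affine_comp_def)
    next
      case 2
      then show ?thesis
        by (simp add: adjoin_scaling_def affine_comp_def msubst_single_var[simplified] mult_single c[OF G])
    qed
  qed (simp add: affine_comp_def adjoin_scaling_def)
next
  fix \<alpha> assume "\<alpha> \<in> G"
  then have "mvars (\<rho> \<alpha> $ k) \<subseteq> {..<m}" if "k < m" for k
    using \<rho> that by (auto simp: faithful_representation_def affine_End_def)
  then show "adjoin_scaling m (c \<alpha>) (\<rho> \<alpha>) \<in> affine_End (Suc m)"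
    using mvars_single_var[of m "c \<alpha>"]
    by (fastforce simp: affine_End_def adjoin_scaling_def less_Suc_eq)
next
  show "inj_on (\<lambda>\<alpha>. adjoin_scaling m (c \<alpha>) (\<rho> \<alpha>)) G"
  proof (rule inj_onI)
    fix \<alpha> \<beta> assume G: "\<alpha> \<in> G" "\<beta> \<in> G"
      and eq: "adjoin_scaling m (c \<alpha>) (\<rho> \<alpha>) = adjoin_scaling m (c \<beta>) (\<rho> \<beta>)"
    have "\<rho> \<alpha> $ k = \<rho> \<beta> $ k" if "k < m" for k
      using arg_cong[OF eq, of "\<lambda>f. f $ k"] that by (simp add: adjoin_scaling_def)
    moreover have "\<rho> \<alpha> \<in> carrier_vec m" "\<rho> \<beta> \<in> carrier_vec m" "inj_on \<rho> G"
      using \<rho> G by (auto simp: faithful_representation_def affine_End_def)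
    ultimately show "\<alpha> = \<beta>" using G by (metis carrier_vecD eq_vecI inj_onD)
  qed
qed

text \<open>
  The old components do not involve the new variable and the new component involves no other,
  so the Jacobian is block diagonal.  The new component is linear, so its derivative is the same
  at every point: the last coordinate of the point is immaterial, and \<open>x $ m\<close>, which lies beyond
  the end of an \<open>m\<close>-dimensional \<open>x\<close>, serves as well as any other value.
\<close>

lemma det_div_seq_adjoin_scaling:
  fixes \<rho> :: "'g \<Rightarrow> 'a::comm_ring_1 mpoly vec"
  assumes "\<rho> \<alpha> \<in> affine_End m"
  shows "det_div_seq (Suc m) (\<lambda>\<alpha>. adjoin_scaling m (c \<alpha>) (\<rho> \<alpha>)) (vec (Suc m) (\<lambda>k. x $ k)) \<alpha> =
    det_div_seq m \<rho> x \<alpha> * c \<alpha>"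
proof -
  let ?f = "adjoin_scaling m (c \<alpha>) (\<rho> \<alpha>)" and ?y = "vec (Suc m) (\<lambda>k. x $ k)"
  have mvars: "mvars (\<rho> \<alpha> $ i) \<subseteq> {..<m}" if "i < m" for i
    using assms that by (simp add: affine_End_def)
  have old: "meval ?y (mpderiv j (\<rho> \<alpha> $ i)) = meval x (mpderiv j (\<rho> \<alpha> $ i))" if "i < m" for i j
    unfolding meval_def using mvars[OF that] mvars_mpderiv[of j "\<rho> \<alpha> $ i"]
    by (intro minsert_cong) fastforce
  have new: "mpderiv m (\<rho> \<alpha> $ i) = 0" if "i < m" for i
    using mvars[OF that] by (intro mpderiv_eq_0) auto
  have eval: "meval x 0 = 0" "meval ?y 0 = 0" "meval ?y (Poly_Mapping.single 0 a) = a" for a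
    by (simp_all add: meval_def minsert_def)
  have "jacobian (Suc m) ?f ?y = four_block_mat (jacobian m (\<rho> \<alpha>) x) (0\<^sub>m m 1) (0\<^sub>m 1 m)
      (mat 1 1 (\<lambda>_. c \<alpha>))"
    by (rule eq_matI)
      (auto simp: jacobian_def adjoin_scaling_def old new eval mpderiv_single lookup_single
        when_def less_Suc_eq)
  then show ?thesis
    unfolding det_div_seq_def
    by (simp add: det_four_block_mat_upper_right_zero_col[of _ m] jacobian_def det_single)
qed

section \<open>Algebraic integers form a ring\<close>

text \<open>
  The complex numbers as a module over the integers; its spans of finite sets are the finitely
  generated additive subgroups that characterise integrality.
\<close>

interpretation int_module: Modules.module "\<lambda>(n::int) (x::complex). of_int n * x"
  by unfold_locales (simp_all add: algebra_simps)

lemma int_span_mult_closed: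
  assumes "\<And>b. b \<in> B \<Longrightarrow> y * b \<in> int_module.span B" "x \<in> int_module.span B"
  shows "y * x \<in> int_module.span B"
  using assms(2)
proof (induction rule: int_module.span_induct_alt)
  case base
  show ?case by (simp add: int_module.span_zero)
next
  case (step n b x)
  have "y * (of_int n * b + x) = of_int n * (y * b) + y * x" by (simp add: algebra_simps)
  with step assms(1) show ?case
    by (simp only: int_module.span_add int_module.span_scale)
qed

text \<open>
  The determinant trick.  Multiplication by \<open>y\<close> on the generators \<open>B\<close> is described by an integer
  matrix; the vector of generators is an eigenvector for \<open>y\<close>, nonzero because \<open>1\<close> is a
  generator.  So \<open>y\<close> is a root of a monic characteristic polynomial with integer coefficients.
\<close>

lemma algebraic_int_if_stable_int_span:
  assumes fin: "finite B" and one: "1 \<in> B"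
    and stable: "\<And>b. b \<in> B \<Longrightarrow> y * b \<in> int_module.span B"
  shows "algebraic_int y"
proof -
  obtain bs where bs: "set bs = B" "distinct bs" using finite_distinct_list[OF fin] by blast
  define N where "N = length bs"
  have "\<exists>c. y * b = (\<Sum>d\<in>B. of_int (c d) * d)" if "b \<in> B" for b
    using stable[OF that] unfolding int_module.span_finite[OF fin] by auto
  then obtain c where c: "\<And>b. b \<in> B \<Longrightarrow> y * b = (\<Sum>d\<in>B. of_int (c b d) * d)" by metis
  define A where "A = mat N N (\<lambda>(i, j). c (bs ! i) (bs ! j))"
  have A: "A \<in> carrier_mat N N" by (simp add: A_def)
  let ?A = "map_mat complex_of_int A" and ?v = "vec N (\<lambda>i. bs ! i)"
  have "?A *\<^sub>v ?v = y \<cdot>\<^sub>v ?v"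
  proof (rule eq_vecI)
    fix i assume "i < dim_vec (y \<cdot>\<^sub>v ?v)"
    then have i: "i < N" by simp
    then have "y * bs ! i = (\<Sum>d\<in>B. of_int (c (bs ! i) d) * d)"
      using c[of "bs ! i"] bs(1) by (auto simp: N_def)
    also have "\<dots> = (\<Sum>j<N. of_int (c (bs ! i) (bs ! j)) * bs ! j)"
      using bs by (intro sum.reindex_bij_betw[symmetric, of "(!) bs"])
        (auto simp: N_def intro: bij_betw_nth)
    finally show "(?A *\<^sub>v ?v) $ i = (y \<cdot>\<^sub>v ?v) $ i"
      using i by (simp add: A_def scalar_prod_def atLeast0LessThan)
  qed (simp add: A_def)
  moreover have "?v \<noteq> 0\<^sub>v N"
  proof
    assume v: "?v = 0\<^sub>v N"
    obtain i where "i < N" "bs ! i = 1" using one bs(1) by (metis N_def in_set_conv_nth)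
    then show False using arg_cong[OF v, of "\<lambda>v. v $ i"] by simp
  qed
  ultimately have "eigenvalue ?A y"
    unfolding eigenvalue_def eigenvector_def using A by (intro exI[of _ ?v]) auto
  then have "poly (char_poly ?A) y = 0"
    using A by (subst (asm) eigenvalue_root_char_poly) auto
  then have "poly (map_poly of_int (char_poly A)) y = 0"
    by (simp add: of_int_hom.char_poly_hom[OF A])
  then show ?thesis
    unfolding algebraic_int_altdef_ipoly using degree_monic_char_poly[OF A] by blast
qed

text \<open>
  If \<open>a\<close> is a root of a monic integer polynomial of degree \<open>d\<close>, the products \<open>b a\<^sup>k\<close> with
  \<open>k < d\<close> generate a group that is stable under \<open>a\<close>, and it remains stable under everything
  under which the span of \<open>B\<close> was.  Two applications yield a group stable under two given
  algebraic integers, hence under their sum and product.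
\<close>

lemma stable_int_span_adjoin:
  assumes a: "algebraic_int a" and B: "finite B" "1 \<in> B"
  obtains B' where "finite B'" "1 \<in> B'" "\<And>b. b \<in> B' \<Longrightarrow> a * b \<in> int_module.span B'"
    "\<And>y. (\<And>b. b \<in> B \<Longrightarrow> y * b \<in> int_module.span B) \<Longrightarrow>
      (\<And>b. b \<in> B' \<Longrightarrow> y * b \<in> int_module.span B')"
proof -
  obtain p :: "int poly" where p: "poly (map_poly of_int p) a = 0" "lead_coeff p = 1"
    using a unfolding algebraic_int_altdef_ipoly by blast
  define d where "d = degree p"
  have "d > 0"
  proof (rule ccontr)
    assume "\<not> d > 0"
    then have "p = [:1:]" using p(2) by (auto simp: d_def elim!: degree_eq_zeroE)
    then show False using p(1) by simp
  qed
  define B' where "B' = (\<lambda>(b, k). b * a ^ k) ` (B \<times> {..<d})"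
  have in_B': "b * a ^ k \<in> int_module.span B'" if "b \<in> B" "k < d" for b k
    using that by (intro int_module.span_base) (force simp: B'_def)
  have "0 = (\<Sum>k\<le>d. of_int (coeff p k) * a ^ k)"
    using p(1) by (simp add: poly_altdef d_def)
  also have "\<dots> = (\<Sum>k<d. of_int (coeff p k) * a ^ k) + a ^ d"
    using p(2) by (simp add: d_def lessThan_Suc_atMost[symmetric])
  finally have a_d: "a ^ d = - (\<Sum>k<d. of_int (coeff p k) * a ^ k)"
    by (simp add: eq_neg_iff_add_eq_0 add.commute)
  \<comment> \<open>The relation \<open>p(a) = 0\<close> rewrites the first power outside the range in terms of the lower ones.\<close>
  have top: "b * a ^ d \<in> int_module.span B'" if "b \<in> B" for b
  proof -
    have "b * a ^ d = - (\<Sum>k<d. of_int (coeff p k) * (b * a ^ k))"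
      unfolding a_d by (simp add: sum_distrib_left mult_ac)
    then show ?thesis
      using in_B'[OF that]
      by (auto intro!: int_module.span_neg int_module.span_sum int_module.span_scale)
  qed
  show thesis
  proof (rule that[of B'])
    show "finite B'" using B by (simp add: B'_def)
    have "(1, 0) \<in> B \<times> {..<d}" using B \<open>d > 0\<close> by simp
    then show "1 \<in> B'" unfolding B'_def by (rule rev_image_eqI) simp
    show "a * b' \<in> int_module.span B'" if "b' \<in> B'" for b'
    proof -
      from that obtain b k where bk: "b \<in> B" "k < d" "b' = b * a ^ k" by (auto simp: B'_def)
      have "a * b' = b * a ^ Suc k" by (simp add: bk(3))
      moreover have "Suc k < d \<or> Suc k = d" using bk(2) by auto
      ultimately show ?thesis using in_B'[OF bk(1)] top[OF bk(1)] by metis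
    qed
    show "y * b' \<in> int_module.span B'"
      if y: "\<And>b. b \<in> B \<Longrightarrow> y * b \<in> int_module.span B" and "b' \<in> B'" for y b'
    proof -
      from that(2) obtain b k where bk: "b \<in> B" "k < d" "b' = b * a ^ k" by (auto simp: B'_def)
      have "x * a ^ k \<in> int_module.span B'" if "x \<in> int_module.span B" for x
        using that
      proof (induction rule: int_module.span_induct_alt)
        case base
        show ?case by (simp add: int_module.span_zero)
      next
        case (step n b x)
        have "(of_int n * b + x) * a ^ k = of_int n * (b * a ^ k) + x * a ^ k"
          by (simp add: algebra_simps)
        with step in_B' bk(2) show ?case
          by (simp only: int_module.span_add int_module.span_scale)
      qed
      from this[OF y[OF bk(1)]] show ?thesis by (simp add: bk(3) mult.assoc)
    qed
  qed
qed

lemma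
  fixes a b :: complex
  assumes "algebraic_int a" "algebraic_int b"
  shows algebraic_int_add: "algebraic_int (a + b)"
    and algebraic_int_mult: "algebraic_int (a * b)"
proof -
  obtain B where B: "finite B" "1 \<in> B" "\<And>x. x \<in> B \<Longrightarrow> a * x \<in> int_module.span B"
    by (rule stable_int_span_adjoin[OF assms(1), of "{1}"]) simp_all
  obtain C where C: "finite C" "1 \<in> C" "\<And>x. x \<in> C \<Longrightarrow> b * x \<in> int_module.span C"
    "\<And>x. x \<in> C \<Longrightarrow> a * x \<in> int_module.span C"
  proof (rule stable_int_span_adjoin[OF assms(2) B(1,2)])
    fix C :: "complex set"
    assume "finite C" "1 \<in> C" "\<And>x. x \<in> C \<Longrightarrow> b * x \<in> int_module.span C"
      and "\<And>y x. (\<And>x. x \<in> B \<Longrightarrow> y * x \<in> int_module.span B) \<Longrightarrow> x \<in> C \<Longrightarrow>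
        y * x \<in> int_module.span C"
    then show thesis using that[of C] B(3) by simp
  qed
  show "algebraic_int (a + b)"
    using C by (intro algebraic_int_if_stable_int_span[of C])
      (auto simp: distrib_right intro: int_module.span_add)
  show "algebraic_int (a * b)"
    using C by (intro algebraic_int_if_stable_int_span[of C])
      (auto simp: mult.assoc intro: int_span_mult_closed)
qed

lemma algebraic_int_sum:
  fixes f :: "'a \<Rightarrow> complex"
  shows "(\<And>i. i \<in> A \<Longrightarrow> algebraic_int (f i)) \<Longrightarrow> algebraic_int (sum f A)"
  by (induction A rule: infinite_finite_induct) (auto intro: algebraic_int_add)

lemma algebraic_int_prod:
  fixes f :: "'a \<Rightarrow> complex"
  shows "(\<And>i. i \<in> A \<Longrightarrow> algebraic_int (f i)) \<Longrightarrow> algebraic_int (prod f A)"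
  by (induction A rule: infinite_finite_induct)
    (auto intro: algebraic_int_mult int_imp_algebraic_int)

lemma algebraic_int_power:
  fixes a :: complex
  shows "algebraic_int a \<Longrightarrow> algebraic_int (a ^ n)"
  by (induction n) (auto intro: algebraic_int_mult int_imp_algebraic_int)

section \<open>Power quotients\<close>

lemma power_quotient_eq_sum:
  "power_quotient n a b = (\<Sum>k<n. a ^ k * b ^ (n - 1 - k))"
proof (cases "a = b")
  case False
  have "a ^ n - b ^ n = (a - b) * (\<Sum>k<n. a ^ k * b ^ (n - 1 - k))"
    by (simp add: power_diff_sumr2 mult.commute)
  with False show ?thesis by (simp add: power_quotient_def)
qed (simp add: power_quotient_def)

lemma power_quotient_commute: "power_quotient n a b = power_quotient n b a"
  unfolding power_quotient_def by (auto simp: minus_divide_divide[of "a ^ n - b ^ n", symmetric])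

lemma power_quotient_diagonal: "power_quotient n a a = of_nat n * a ^ (n - 1)"
  by (simp add: power_quotient_def flip: power_add)

text \<open>
  Off the diagonal this is \<open>(a\<^bsup>nk\<^esup> - b\<^bsup>nk\<^esup>) / (a - b)\<close> expanded by \<open>a\<^sup>n - b\<^sup>n\<close>.  It persists
  when \<open>a\<^sup>n = b\<^sup>n\<close> although \<open>a \<noteq> b\<close>, since both sides are then zero.
\<close>

lemma power_quotient_mult:
  assumes "n \<ge> 1" "k \<ge> 1"
  shows "power_quotient (n * k) a b = power_quotient n a b * power_quotient k (a ^ n) (b ^ n)"
proof (cases "a = b")
  case True
  have "n * k - 1 = (n - 1) + n * (k - 1)" using assms by (simp add: diff_mult_distrib2)
  with True show ?thesis
    by (simp add: power_quotient_diagonal power_add mult_ac flip: power_mult)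
qed (auto simp: power_quotient_def power_mult)

lemma algebraic_int_power_quotient:
  assumes "algebraic_int a" "algebraic_int b"
  shows "algebraic_int (power_quotient n a b)"
  unfolding power_quotient_eq_sum
  by (intro algebraic_int_sum algebraic_int_mult algebraic_int_power assms)

lemma prod_square_split:
  fixes f :: "nat \<Rightarrow> nat \<Rightarrow> 'a::comm_monoid_mult"
  shows "(\<Prod>i<r. \<Prod>j<r. f i j) =
    (\<Prod>i<r. f i i) * (\<Prod>(i, j)\<in>{(i, j). i < j \<and> j < r}. f i j * f j i)"
proof (induction r)
  case (Suc r)
  have pairs: "{(i, j). i < j \<and> j < Suc r} = {(i, j). i < j \<and> j < r} \<union> (\<lambda>i. (i, r)) ` {..<r}"
    by auto
  have "finite {(i, j). i < j \<and> j < r}"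
    by (rule finite_subset[of _ "{..<r} \<times> {..<r}"]) auto
  then have "(\<Prod>(i, j)\<in>{(i, j). i < j \<and> j < Suc r}. f i j * f j i) =
      (\<Prod>(i, j)\<in>{(i, j). i < j \<and> j < r}. f i j * f j i) * (\<Prod>i<r. f i r * f r i)"
    unfolding pairs by (subst prod.union_disjoint) (auto simp: prod.reindex inj_on_def)
  then show ?case using Suc by (simp add: prod.distrib mult_ac)
qed simp

text \<open>
  For distinct eigenvalues this is the quotient of the discriminant of the characteristic
  polynomial of \<open>X\<^sup>n\<close> by that of \<open>X\<close>.
\<close>

definition eigen_quotient :: "nat \<Rightarrow> complex list \<Rightarrow> nat \<Rightarrow> complex" where
  "eigen_quotient r ev n =
     (\<Prod>(i, j)\<in>{(i, j). i < j \<and> j < r}. power_quotient n (ev ! i) (ev ! j) ^ 2)"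

lemma eigen_quotient_mult:
  assumes "n \<ge> 1" "k \<ge> 1" "length ev = r"
  shows "eigen_quotient r ev (n * k) =
    eigen_quotient r ev n * eigen_quotient r (map (\<lambda>a. a ^ n) ev) k"
  unfolding eigen_quotient_def prod.distrib[symmetric] using assms
  by (intro prod.cong) (auto simp: power_quotient_mult power_mult_distrib)

lemma prod_power_quotient:
  "(\<Prod>i<r. \<Prod>j<r. power_quotient n (ev ! i) (ev ! j)) =
     of_nat n ^ r * (\<Prod>i<r. ev ! i) ^ (n - 1) * eigen_quotient r ev n"
proof -
  have "(\<Prod>i<r. power_quotient n (ev ! i) (ev ! i)) = of_nat n ^ r * (\<Prod>i<r. ev ! i) ^ (n - 1)"
    by (simp add: power_quotient_diagonal prod.distrib prod_power_distrib)
  moreover have "(\<Prod>(i, j)\<in>{(i, j). i < j \<and> j < r}.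
      power_quotient n (ev ! i) (ev ! j) * power_quotient n (ev ! j) (ev ! i)) = eigen_quotient r ev n"
    unfolding eigen_quotient_def
    by (intro prod.cong refl) (auto simp: power2_eq_square power_quotient_commute)
  ultimately show ?thesis by (simp only: prod_square_split)
qed

section \<open>The Jacobian determinant\<close>

text \<open>
  The order of the diagonal matters: it lets a matrix and its transpose be triangularised with
  the same eigenvalue in each position.
\<close>

lemma triangularization:
  fixes A :: "complex mat"
  assumes A: "A \<in> carrier_mat r r" and cp: "char_poly A = (\<Prod>a\<leftarrow>ev. [:- a, 1:])"
  obtains U P Q where "similar_mat_wit A U P Q" "U \<in> carrier_mat r r" "upper_triangular U"
    "diag_mat U = ev" "\<And>i. i < r \<Longrightarrow> U $$ (i, i) = ev ! i"
proof -
  obtain U P Q where "schur_decomposition A ev = (U, P, Q)" by (metis prod_cases3)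
  from schur_decomposition[OF A cp this]
  have U: "similar_mat_wit A U P Q" "upper_triangular U" "diag_mat U = ev" by auto
  then have carrier: "U \<in> carrier_mat r r" using similar_mat_witD2[OF A] by blast
  have "U $$ (i, i) = ev ! i" if "i < r" for i
    using U(3) carrier that by (auto simp: diag_mat_def)
  with U carrier show thesis by (intro that)
qed

lemma det_eq_prod_eigenvalues:
  fixes A :: "complex mat"
  assumes "A \<in> carrier_mat r r" "char_poly A = (\<Prod>a\<leftarrow>ev. [:- a, 1:])"
  shows "det A = (\<Prod>i<r. ev ! i)"
proof -
  obtain U P Q where U: "similar_mat_wit A U P Q" "U \<in> carrier_mat r r" "upper_triangular U"
    "\<And>i. i < r \<Longrightarrow> U $$ (i, i) = ev ! i"
    using triangularization[OF assms] by metis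
  have "det A = det U" using U(1) by (intro det_similar) (auto simp: similar_mat_def)
  also have "\<dots> = (\<Prod>i<r. ev ! i)"
    using U by (simp add: det_upper_triangular[of _ r] prod_list_diag_prod atLeast0LessThan)
  finally show ?thesis .
qed

lemma char_poly_pow_mat:
  fixes A :: "complex mat"
  assumes "A \<in> carrier_mat r r" "char_poly A = (\<Prod>a\<leftarrow>ev. [:- a, 1:])"
  shows "char_poly (A ^\<^sub>m n) = (\<Prod>a\<leftarrow>map (\<lambda>a. a ^ n) ev. [:- a, 1:])"
proof -
  obtain U P Q where U: "similar_mat_wit A U P Q" "U \<in> carrier_mat r r" "upper_triangular U"
    "diag_mat U = ev"
    using triangularization[OF assms] by metis
  have "char_poly (A ^\<^sub>m n) = char_poly (U ^\<^sub>m n)"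
    using similar_mat_wit_pow[OF U(1)] by (intro char_poly_similar) (auto simp: similar_mat_def)
  also have "\<dots> = (\<Prod>a\<leftarrow>diag_mat (U ^\<^sub>m n). [:- a, 1:])"
    using U by (intro char_poly_upper_triangular[of _ r] upper_triangular_pow(1)) auto
  also have "diag_mat (U ^\<^sub>m n) = map (\<lambda>a. a ^ n) (diag_mat U)"
    using U(2) by (simp add: diag_mat_def upper_triangular_pow(2)[OF U(2,3)])
  finally show ?thesis by (simp add: U(4))
qed

text \<open>
  Triangularising the first factor as \<open>A\<close> and the second as its transpose, rather than
  transposing the triangular form of \<open>A\<close>, keeps both factors upper triangular.
\<close>

lemma det_kronecker_quotient:
  fixes A :: "complex mat"
  assumes A: "A \<in> carrier_mat r r" and cp: "char_poly A = (\<Prod>a\<leftarrow>ev. [:- a, 1:])"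
  shows "det (kronecker_quotient r n A A\<^sup>T) =
    (\<Prod>i<r. \<Prod>j<r. power_quotient n (ev ! i) (ev ! j))"
proof -
  have AT: "A\<^sup>T \<in> carrier_mat r r" "char_poly A\<^sup>T = (\<Prod>a\<leftarrow>ev. [:- a, 1:])"
    using A cp by simp_all
  obtain U P Q where U: "similar_mat_wit A U P Q" "U \<in> carrier_mat r r" "upper_triangular U"
    "\<And>i. i < r \<Longrightarrow> U $$ (i, i) = ev ! i"
    using triangularization[OF A cp] by metis
  obtain V S T where V: "similar_mat_wit A\<^sup>T V S T" "V \<in> carrier_mat r r" "upper_triangular V"
    "\<And>i. i < r \<Longrightarrow> V $$ (i, i) = ev ! i"
    using triangularization[OF AT] by metis
  have "det (kronecker_quotient r n A A\<^sup>T) = det (kronecker_quotient r n U V)"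
    by (intro det_similar similar_kronecker_quotient[OF A U(1) AT(1) V(1)])
  also have "\<dots> = (\<Prod>i<r. \<Prod>j<r. power_quotient n (ev ! i) (ev ! j))"
    by (simp add: det_kronecker_quotient_upper_triangular[OF U(2,3) V(2,3)] U(4) V(4)
        power_quotient_eq_sum)
  finally show ?thesis .
qed

lemma det_div_seq_matrix_power_hom:
  assumes "comm_ring_hom h" and X: "X \<in> carrier_mat r r"
  shows "det_div_seq (r * r) (matrix_power_endo r) (point_of_mat r (map_mat h X)) n =
    h (det_div_seq (r * r) (matrix_power_endo r) (point_of_mat r X) n)"
proof -
  interpret comm_ring_hom h by fact
  have pow: "(map_mat h A) ^\<^sub>m k = map_mat h (A ^\<^sub>m k)" if "A \<in> carrier_mat r r" for A k
    using mat_hom_pow[OF that] by simp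
  have "map_mat h (kronecker_quotient r n X X\<^sup>T) = kronecker_quotient r n (map_mat h X) (map_mat h X\<^sup>T)"
    using X by (intro eq_matI)
      (auto simp: kronecker_quotient_def kronecker_def hom_sum hom_mult pow row_major_index_inverse)
  then show ?thesis
    using X unfolding det_div_seq_def
    by (simp add: jacobian_matrix_power_endo[of _ r] map_mat_transpose flip: hom_det)
qed

lemma det_div_seq_matrix_power:
  fixes X :: "int mat"
  assumes X: "X \<in> carrier_mat r r"
    and cp: "char_poly (map_mat complex_of_int X) = (\<Prod>a\<leftarrow>ev. [:- a, 1:])"
  shows "complex_of_int (det_div_seq (r * r) (matrix_power_endo r) (point_of_mat r X) n) =
    of_nat n ^ r * of_int (det X) ^ (n - 1) * eigen_quotient r ev n"
proof -
  let ?X = "map_mat complex_of_int X"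
  have X': "?X \<in> carrier_mat r r" using X by simp
  have "complex_of_int (det_div_seq (r * r) (matrix_power_endo r) (point_of_mat r X) n) =
      det_div_seq (r * r) (matrix_power_endo r) (point_of_mat r ?X) n"
    by (rule det_div_seq_matrix_power_hom[symmetric, OF _ X]) unfold_locales
  also have "\<dots> = (\<Prod>i<r. \<Prod>j<r. power_quotient n (ev ! i) (ev ! j))"
    unfolding det_div_seq_def jacobian_matrix_power_endo[OF X']
    by (rule det_kronecker_quotient[OF X' cp])
  also have "\<dots> = of_nat n ^ r * det ?X ^ (n - 1) * eigen_quotient r ev n"
    by (simp only: prod_power_quotient det_eq_prod_eigenvalues[OF X' cp])
  finally show ?thesis by (simp only: of_int_hom.hom_det)
qed

section \<open>Integrality and divisibility\<close>

lemma algebraic_int_eigenvalue: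
  fixes X :: "int mat"
  assumes X: "X \<in> carrier_mat r r"
    and cp: "char_poly (map_mat complex_of_int X) = (\<Prod>a\<leftarrow>ev. [:- a, 1:])" and "a \<in> set ev"
  shows "algebraic_int a"
proof -
  have "poly (\<Prod>a\<leftarrow>ev. [:- a, 1:]) a = 0"
    using \<open>a \<in> set ev\<close> by (auto simp: poly_prod_list prod_list_zero_iff)
  then have "poly (map_poly of_int (char_poly X)) a = 0"
    by (simp add: of_int_hom.char_poly_hom[OF X] flip: cp)
  then show ?thesis
    unfolding algebraic_int_altdef_ipoly using degree_monic_char_poly[OF X] by blast
qed

text \<open>
  The Jacobian determinant alone only shows that \<open>n\<^sup>r (det X)\<^bsup>n-1\<^esup>\<close> times the quotient is an
  integer.  This makes the quotient rational, and an algebraic integer that is rational is an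
  integer.
\<close>

lemma eigen_quotient_Ints:
  fixes X :: "int mat"
  assumes X: "X \<in> carrier_mat r r" and det: "det X \<noteq> 0" and len: "length ev = r"
    and cp: "char_poly (map_mat complex_of_int X) = (\<Prod>a\<leftarrow>ev. [:- a, 1:])" and n: "n \<ge> 1"
  shows "eigen_quotient r ev n \<in> \<int>"
proof (rule rational_algebraic_int_is_int)
  have "algebraic_int (ev ! i)" if "i < r" for i
    using algebraic_int_eigenvalue[OF X cp] that len by simp
  then show "algebraic_int (eigen_quotient r ev n)"
    unfolding eigen_quotient_def
    by (intro algebraic_int_prod)
      (auto intro!: algebraic_int_power algebraic_int_power_quotient)
  let ?J = "det_div_seq (r * r) (matrix_power_endo r) (point_of_mat r X) n"
  have "eigen_quotient r ev n = of_int ?J / (of_nat n ^ r * of_int (det X) ^ (n - 1))"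
    using det_div_seq_matrix_power[OF X cp, of n] det n by (simp add: field_simps)
  then show "eigen_quotient r ev n \<in> \<rat>" by simp
qed

text \<open>
  The cofactor of \<open>D n\<close> in \<open>D (n * k)\<close> is \<open>k\<^sup>s (det X)\<^bsup>n(k-1)\<^esup>\<close> times the eigenvalue quotient of
  the integer matrix \<open>X\<^sup>n\<close>.
\<close>

lemma divisibility_sequence_eigen_quotient:
  fixes X :: "int mat" and D :: "nat \<Rightarrow> int"
  assumes X: "X \<in> carrier_mat r r" and det: "det X \<noteq> 0" and len: "length ev = r"
    and cp: "char_poly (map_mat complex_of_int X) = (\<Prod>a\<leftarrow>ev. [:- a, 1:])"
    and D: "\<And>n. n \<ge> 1 \<Longrightarrow>
      complex_of_int (D n) = of_nat n ^ s * of_int (det X) ^ (n - 1) * eigen_quotient r ev n"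
  shows "divisibility_sequence D"
  unfolding divisibility_sequence_def
proof (intro allI impI)
  fix n m :: nat assume n: "n \<ge> 1" and m: "m \<ge> 1" and "n dvd m"
  then obtain k where k: "m = n * k" "k \<ge> 1" by (auto elim!: dvdE)
  have Xn: "X ^\<^sub>m n \<in> carrier_mat r r" using X by simp
  have "det (X ^\<^sub>m n) = det X ^ n"
    using X by (induction n) (simp_all add: det_mult[of _ r] mult.commute)
  then have "det (X ^\<^sub>m n) \<noteq> 0" using det by simp
  moreover have "char_poly (map_mat complex_of_int (X ^\<^sub>m n)) =
      (\<Prod>a\<leftarrow>map (\<lambda>a. a ^ n) ev. [:- a, 1:])"
    using X cp by (simp only: of_int_hom.mat_hom_pow[OF X]) (rule char_poly_pow_mat[of _ r], auto)
  ultimately have "eigen_quotient r (map (\<lambda>a. a ^ n) ev) k \<in> \<int>"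
    using eigen_quotient_Ints[OF Xn] len k(2) by simp
  then obtain q where q: "eigen_quotient r (map (\<lambda>a. a ^ n) ev) k = of_int q"
    by (auto elim: Ints_cases)
  have "n * k - 1 = (n - 1) + n * (k - 1)" using n k(2) by (simp add: diff_mult_distrib2)
  then have "complex_of_int (D m) = of_int (D n * (of_nat k ^ s * det X ^ (n * (k - 1)) * q))"
    using D[OF n] D[OF m] eigen_quotient_mult[OF n k(2) len] q
    by (simp add: k(1) power_add power_mult_distrib mult_ac)
  then have "D m = D n * (of_nat k ^ s * det X ^ (n * (k - 1)) * q)"
    by (simp only: of_int_eq_iff)
  then show "D n dvd D m" by simp
qed

section \<open>The determinant divisibility sequences\<close>

lemma det_nonzero_if_invertible_int_mat:
  fixes X :: "int mat"
  assumes X: "X \<in> carrier_mat r r" and inv: "invertible_mat X"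
  shows "det X \<noteq> 0"
proof -
  obtain Y where Y: "X * Y = 1\<^sub>m (dim_row X)" "Y * X = 1\<^sub>m (dim_row Y)"
    using inv by (auto simp: invertible_mat_def inverts_mat_def)
  have "Y \<in> carrier_mat r r"
    using arg_cong[OF Y(1), of dim_col] arg_cong[OF Y(2), of dim_col] X by auto
  then have "det X * det Y = 1" using det_mult[OF X, of Y] Y(1) X by simp
  then show ?thesis by auto
qed

text \<open>
  The factor \<open>n\<^sup>s / n\<^sup>r\<close> between \<open>D\<close> and the Jacobian determinant of the power map is
  multiplicative in \<open>n\<close>, so it can be supplied by an extra coordinate scaled by it.
\<close>

lemma is_det_div_seq_rescaled_matrix_power:
  fixes X :: "int mat" and D :: "nat \<Rightarrow> int"
  assumes X: "X \<in> carrier_mat r r" and r: "r \<ge> 1"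
    and D: "\<And>n. n \<ge> 1 \<Longrightarrow> of_nat n ^ r * D n =
      of_nat n ^ s * det_div_seq (r * r) (matrix_power_endo r) (point_of_mat r X) n"
  shows "is_det_div_seq {1..} (\<lambda>n. rat_of_int (D n))"
proof -
  let ?\<rho> = "matrix_power_endo r :: nat \<Rightarrow> rat mpoly vec"
  let ?c = "\<lambda>n. (of_nat n ^ s / of_nat n ^ r :: rat)"
  let ?x = "point_of_mat r (map_mat rat_of_int X)"
  have faithful: "faithful_representation {1..} (r * r) ?\<rho>" by (rule faithful_matrix_power_endo[OF r])
  then have "faithful_representation {1..} (Suc (r * r)) (\<lambda>n. adjoin_scaling (r * r) (?c n) (?\<rho> n))"
    by (rule faithful_adjoin_scaling) (simp add: power_mult_distrib)
  moreover have "rat_of_int (D n) = det_div_seq (Suc (r * r))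
      (\<lambda>n. adjoin_scaling (r * r) (?c n) (?\<rho> n)) (vec (Suc (r * r)) (\<lambda>k. ?x $ k)) n"
    if n: "n \<in> {1..}" for n
  proof -
    have "det_div_seq (Suc (r * r))
        (\<lambda>n. adjoin_scaling (r * r) (?c n) (?\<rho> n)) (vec (Suc (r * r)) (\<lambda>k. ?x $ k)) n =
        det_div_seq (r * r) ?\<rho> ?x n * ?c n"
      using faithful n
      by (intro det_div_seq_adjoin_scaling) (simp add: faithful_representation_def)
    also have "det_div_seq (r * r) ?\<rho> ?x n =
        of_int (det_div_seq (r * r) (matrix_power_endo r) (point_of_mat r X) n)"
      by (rule det_div_seq_matrix_power_hom[OF _ X]) unfold_locales
    also have "\<dots> * ?c n = of_int (of_nat n ^ r * D n) / of_nat n ^ r"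
      using n by (simp only: D atLeast_iff) simp
    finally show ?thesis using n by simp
  qed
  ultimately show ?thesis
    unfolding is_det_div_seq_def
    by (intro exI[of _ "Suc (r * r)"] exI[of _ "\<lambda>n. adjoin_scaling (r * r) (?c n) (?\<rho> n)"]
        exI[of _ "vec (Suc (r * r)) (\<lambda>k. ?x $ k)"]) auto
qed

theorem theorem3p1:
  fixes X :: "int mat" and r :: nat and ev :: "complex list"
  assumes "r \<ge> 1"
    and "X \<in> carrier_mat r r"
    and "invertible_mat X"
    and "length ev = r"
    and "char_poly (map_mat complex_of_int X) = (\<Prod>a\<leftarrow>ev. [:- a, 1:])"
  shows
    "(\<exists>D :: nat \<Rightarrow> int.
        (\<forall>n\<ge>1. complex_of_int (D n) =
           of_nat n ^ 2 * of_int (det X) ^ (n - 1) *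
           (\<Prod>(i, j)\<in>{(i, j). i < j \<and> j < r}. power_quotient n (ev ! i) (ev ! j) ^ 2)) \<and>
        divisibility_sequence D \<and>
        is_det_div_seq {1..} (\<lambda>n. rat_of_int (D n))) \<and>
     faithful_representation {1..} (r * r) (matrix_power_endo r :: nat \<Rightarrow> int mpoly vec) \<and>
     divisibility_sequence (det_div_seq (r * r) (matrix_power_endo r) (point_of_mat r X)) \<and>
     (\<forall>n\<ge>1. complex_of_int (det_div_seq (r * r) (matrix_power_endo r) (point_of_mat r X) n) =
        of_nat n ^ r * of_int (det X) ^ (n - 1) *
        (\<Prod>(i, j)\<in>{(i, j). i < j \<and> j < r}. power_quotient n (ev ! i) (ev ! j) ^ 2))"
proof -
  note r = assms(1) and X = assms(2) and len = assms(4) and cp = assms(5)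
  have det: "det X \<noteq> 0" by (rule det_nonzero_if_invertible_int_mat[OF assms(2,3)])
  let ?J = "det_div_seq (r * r) (matrix_power_endo r) (point_of_mat r X)"
  have "\<forall>n. \<exists>q. n \<ge> 1 \<longrightarrow> eigen_quotient r ev n = of_int q"
    using eigen_quotient_Ints[OF X det len cp] by (metis Ints_cases)
  then obtain F where F: "\<And>n. n \<ge> 1 \<Longrightarrow> eigen_quotient r ev n = of_int (F n)" by metis
  define D where "D n = of_nat n ^ 2 * det X ^ (n - 1) * F n" for n
  have D: "complex_of_int (D n) = of_nat n ^ 2 * of_int (det X) ^ (n - 1) * eigen_quotient r ev n"
    if "n \<ge> 1" for n
    using F[OF that] by (simp add: D_def)
  note J = det_div_seq_matrix_power[OF X cp]
  have rescaled: "of_nat n ^ r * D n = of_nat n ^ 2 * ?J n" if "n \<ge> 1" for n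
  proof -
    have "complex_of_int (of_nat n ^ r * D n) = of_int (of_nat n ^ 2 * ?J n)"
      using D[OF that] J[of n] by (simp add: mult_ac)
    then show ?thesis by (simp only: of_int_eq_iff)
  qed
  have "is_det_div_seq {1..} (\<lambda>n. rat_of_int (D n))"
    by (rule is_det_div_seq_rescaled_matrix_power[OF X r rescaled])
  moreover have "divisibility_sequence D"
    using D by (rule divisibility_sequence_eigen_quotient[OF X det len cp])
  moreover have "divisibility_sequence ?J"
    using J by (rule divisibility_sequence_eigen_quotient[OF X det len cp])
  ultimately show ?thesis
    using D J faithful_matrix_power_endo[OF r, where 'a = int]
    unfolding eigen_quotient_def by blast
qed

end
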